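(* Let $n\ge 1$ and let $g$ be the Semi-Riemannian metric on $GL_n=GL_n(\mathbb{R})$ given by $g_A(V,W)=\mathrm{tr}(A^{-1}VA^{-1}W)$ for $A\in GL_n$, $V,W\in T_A(GL_n)=M_n(\mathbb{R})$. Let $K_0,K_1\in GL_n$. If there is a unique geodesic arc of $(GL_n,g)$ joining $K_0$ and $K_1$, then it can be written as $\gamma(t)=K_0(K_0^{-1}K_1)^t$.
   Context: A geodesic arc joining $K_0$ and $K_1$ is any geodesic $\gamma:[0,1]\to GL_n$ of $(GL_n,g)$ with $\gamma(0)=K_0$, $\gamma(1)=K_1$ (constant curves are regarded as geodesics). Real powers of matrices: let $J_k(\lambda)=\lambda I_k+N_k$ be the Jordan block of order $k$ and eigenvalue $\lambda$, where $N_k$ has $(i,j)$ entry $\delta_{i+1,j}$. For $\lambda>0$ and $t\in\mathbb{R}$ set $J_k(\lambda)^t=\lambda^t\left(I_k+\sum_{s=1}^{k-1}\binom{t}{s}\frac{N_k^s}{\lambda^s}\right)$, with $\binom{t}{s}=\frac{t(t-1)\cdots(t-s+1)}{s!}$. If $X=C^{-1}\mathrm{diag}(J_{k_1}(\lambda_1),\dots,J_{k_p}(\lambda_p))C$ with $C\in GL_n$, $\lambda_1,\dots,\lambda_p>0$ and $(\lambda_i,k_i)\neq(\lambda_j,k_j)$ for $i\neq j$, then $X$ has a unique real logarithm $\mathrm{LOG}(X)$ (the unique real $Y$ with $\exp(Y)=X$), and $X^t:=\exp(t\,\mathrm{LOG}(X))=C^{-1}\mathrm{diag}(J_{k_1}(\lambda_1)^t,\dots,J_{k_p}(\lambda_p)^t)C$.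 When the geodesic arc joining $K_0$ and $K_1$ is unique, $X=K_0^{-1}K_1$ is of this form, so $(K_0^{-1}K_1)^t$ has this meaning. *)

theory Defs
  imports
    Jordan_Normal_Form.Jordan_Normal_Form
    "HOL-Analysis.Analysis"
    "HOL-Library.Countable_Set"
begin

text \<open>
  Both \<open>Jordan_Normal_Form\<close> and \<open>HOL-Analysis\<close> provide vectors and matrices.
  Everything below is about \<open>HOL-Analysis\<close> matrices \<open>real^'n^'n\<close>;
  \<open>Jordan_Normal_Form\<close> only contributes \<open>jordan_matrix\<close>.
\<close>

no_notation vec_index (infixl \<open>$\<close> 100)
hide_const (open) Matrix.mat Matrix.row Matrix.vec


section \<open>Geodesics of a Semi-Riemannian metric on an open subset of a Euclidean space\<close>

text \<open>
  On an open set \<open>U\<close> of a vector space, a connection is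
  \<open>\<nabla>_V W = D_V W + \<Gamma>(V, W)\<close>. Tested on constant vector fields, vanishing torsion
  is the symmetry of \<open>\<Gamma>\<close>, and compatibility with the metric is
  \<open>Z(g(V, W)) = g(\<nabla>_Z V, W) + g(V, \<nabla>_Z W)\<close>. These conditions determine \<open>\<Gamma>\<close> on \<open>U\<close>
  when \<open>g\<close> is smooth and nondegenerate.
\<close>

definition levi_civita_on ::
  "'a::euclidean_space set \<Rightarrow> ('a \<Rightarrow> 'a \<Rightarrow> 'a \<Rightarrow> real) \<Rightarrow> ('a \<Rightarrow> 'a \<Rightarrow> 'a \<Rightarrow> 'a) \<Rightarrow> bool" where
  "levi_civita_on U g \<Gamma> \<longleftrightarrow>
     (\<forall>A\<in>U. bilinear (\<Gamma> A) \<and>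
       (\<forall>V W. \<Gamma> A V W = \<Gamma> A W V) \<and>
       (\<forall>V W. ((\<lambda>B. g B V W) has_derivative
                 (\<lambda>Z. g A (\<Gamma> A Z V) W + g A V (\<Gamma> A Z W))) (at A)))"

text \<open>
  In the following definition \<open>d k\<close> is the \<open>k\<close>-th derivative of the (smooth) curve, one-sided
  at the end points, and the last equation is \<open>\<nabla>_(\<gamma>') \<gamma>' = 0\<close>. The values of \<open>\<gamma>\<close>
  outside \<open>[0,1]\<close> are irrelevant.
\<close>

definition geodesic_arc ::
  "'a::euclidean_space set \<Rightarrow> ('a \<Rightarrow> 'a \<Rightarrow> 'a \<Rightarrow> real) \<Rightarrow> 'a \<Rightarrow> 'a \<Rightarrow> (real \<Rightarrow> 'a) \<Rightarrow> bool" where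
  "geodesic_arc U g p q \<gamma> \<longleftrightarrow>
     \<gamma> 0 = p \<and> \<gamma> 1 = q \<and>
     (\<exists>\<Gamma> d. levi_civita_on U g \<Gamma> \<and>
       (\<forall>t\<in>{0..1}.
          \<gamma> t \<in> U \<and>
          d 0 t = \<gamma> t \<and>
          (\<forall>k::nat. (d k has_vector_derivative d (Suc k) t) (at t within {0..1})) \<and>
          d 2 t + \<Gamma> (\<gamma> t) (d 1 t) (d 1 t) = 0))"

definition unique_geodesic_arc ::
  "'a::euclidean_space set \<Rightarrow> ('a \<Rightarrow> 'a \<Rightarrow> 'a \<Rightarrow> real) \<Rightarrow> 'a \<Rightarrow> 'a \<Rightarrow> (real \<Rightarrow> 'a) \<Rightarrow> bool" where
  "unique_geodesic_arc U g p q \<gamma> \<longleftrightarrow>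
     geodesic_arc U g p q \<gamma> \<and>
     (\<forall>\<delta>. geodesic_arc U g p q \<delta> \<longrightarrow> (\<forall>t\<in>{0..1}. \<delta> t = \<gamma> t))"


section \<open>The general linear group with its trace metric\<close>

definition GL :: "(real^'n^'n) set" where
  "GL = {A. invertible A}"

definition gl_metric :: "real^'n^'n \<Rightarrow> real^'n^'n \<Rightarrow> real^'n^'n \<Rightarrow> real" where
  "gl_metric A V W = trace (matrix_inv A ** V ** matrix_inv A ** W)"


section \<open>Exponential, logarithm and real powers of matrices\<close>

text \<open>The multiplication \<open>*\<close> of type \<open>real^'n^'n\<close>, hence also \<open>^\<close>, is componentwise.\<close>

definition matrix_pow :: "real^'n^'n \<Rightarrow> nat \<Rightarrow> real^'n^'n" where
  "matrix_pow A k = (((**) A) ^^ k) (mat 1)"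

definition matrix_exp :: "real^'n^'n \<Rightarrow> real^'n^'n" where
  "matrix_exp A = (\<Sum>k. (1 / fact k) *\<^sub>R matrix_pow A k)"

text \<open>Meaningful only if \<open>X\<close> has exactly one real logarithm.\<close>

definition matrix_LOG :: "real^'n^'n \<Rightarrow> real^'n^'n" where
  "matrix_LOG X = (THE Y. matrix_exp Y = X)"

definition matrix_powr :: "real^'n^'n \<Rightarrow> real \<Rightarrow> real^'n^'n" where
  "matrix_powr X t = matrix_exp (t *\<^sub>R matrix_LOG X)"

text \<open>
  Reads a matrix with indices \<open>0, \<dots>, CARD('n) - 1\<close> as one indexed by \<open>'n\<close>, along a
  fixed enumeration of \<open>'n\<close>. Another enumeration would only conjugate the result by a
  permutation matrix.
\<close>

definition from_nat_indexed :: "real Matrix.mat \<Rightarrow> real^'n^'n" where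
  "from_nat_indexed M =
     (\<chi> i j. M $$ (to_nat_on (UNIV :: 'n set) i, to_nat_on (UNIV :: 'n set) j))"

text \<open>
  \<open>X = C\<^sup>-\<^sup>1 diag(J_k\<^sub>1(\<lambda>\<^sub>1), \<dots>, J_k\<^sub>p(\<lambda>\<^sub>p)) C\<close> with
  all \<open>\<lambda>\<^sub>i\<close> positive and the pairs \<open>(k\<^sub>i, \<lambda>\<^sub>i)\<close> pairwise distinct.
\<close>

definition positive_distinct_jordan :: "real^'n^'n \<Rightarrow> bool" where
  "positive_distinct_jordan (X :: real^'n^'n) \<longleftrightarrow>
     (\<exists>(C :: real^'n^'n) blocks.
        invertible C \<and>
        distinct blocks \<and>
        (\<forall>(k, r) \<in> set blocks. k \<ge> 1 \<and> r > 0) \<and>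
        sum_list (map fst blocks) = CARD('n) \<and>
        X = matrix_inv C ** from_nat_indexed (jordan_matrix blocks) ** C)"

end

theory Submission
  imports
    Defs
    Jordan_Normal_Form.Jordan_Normal_Form_Existence
    "HOL-Computational_Algebra.Field_as_Ring"
begin

text \<open>
  The geodesics starting at \<open>K\<^sub>0\<close> are the curves \<open>t \<mapsto> K\<^sub>0 exp(tV)\<close>, because the geodesic equation
  \<open>\<gamma>'' = \<gamma>' \<gamma>\<^sup>-\<^sup>1 \<gamma>'\<close> says that \<open>\<gamma>\<^sup>-\<^sup>1 \<gamma>'\<close> is constant. Hence a unique geodesic arc from \<open>K\<^sub>0\<close> to
  \<open>K\<^sub>1\<close> amounts to a unique real logarithm \<open>Y\<close> of \<open>X = K\<^sub>0\<^sup>-\<^sup>1 K\<^sub>1\<close>.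

  If \<open>J \<noteq> 0\<close> commutes with \<open>X\<close> and \<open>J\<^sup>3 = -J\<close>, then uniqueness of \<open>Y\<close> makes \<open>J\<close> commute with \<open>Y\<close>, and
  \<open>exp(2\<pi>J) = 1\<close>, so that \<open>Y + 2\<pi>J\<close> is another logarithm. Therefore no such \<open>J\<close> exists. A non-real
  eigenvalue of \<open>X\<close>, a negative eigenvalue of \<open>X\<close> (a non-real one of its square root \<open>exp(Y/2)\<close>), or
  a repeated Jordan block of \<open>X\<close> would each produce one.
\<close>

text \<open>The second import restores the notation and the names that \<open>Defs\<close> disables.\<close>

no_notation vec_index (infixl \<open>$\<close> 100)
hide_const (open) Matrix.mat Matrix.row Matrix.vec

section \<open>The Banach algebra of endomorphisms\<close>

text \<open>Multiplication on \<open>real^'n^'n\<close> is already componentwise. A separate type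
  lets composition be the ring product and the operator norm the submultiplicative norm, so that
  \<open>exp\<close> and its laws for Banach algebras apply.\<close>

typedef 'n endo = "UNIV :: ((real^('n::finite)) \<Rightarrow>\<^sub>L (real^'n)) set"
  morphisms blinfun_of_endo endo_of_blinfun by simp

setup_lifting type_definition_endo

instantiation endo :: (finite) real_normed_algebra_1
begin

lift_definition zero_endo :: "'a endo" is 0 .
lift_definition one_endo :: "'a endo" is id_blinfun .
lift_definition plus_endo :: "'a endo \<Rightarrow> 'a endo \<Rightarrow> 'a endo" is "(+)" .
lift_definition minus_endo :: "'a endo \<Rightarrow> 'a endo \<Rightarrow> 'a endo" is "(-)" .
lift_definition uminus_endo :: "'a endo \<Rightarrow> 'a endo" is uminus .
lift_definition times_endo :: "'a endo \<Rightarrow> 'a endo \<Rightarrow> 'a endo" is "(o\<^sub>L)" .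
lift_definition scaleR_endo :: "real \<Rightarrow> 'a endo \<Rightarrow> 'a endo" is "scaleR" .
lift_definition norm_endo :: "'a endo \<Rightarrow> real" is norm .
lift_definition dist_endo :: "'a endo \<Rightarrow> 'a endo \<Rightarrow> real" is dist .
definition sgn_endo :: "'a endo \<Rightarrow> 'a endo" where
  "sgn_endo x = scaleR (inverse (norm x)) x"
definition uniformity_endo :: "('a endo \<times> 'a endo) filter" where
  "uniformity_endo = (INF e\<in>{0<..}. principal {(x :: 'a endo, y). dist x y < e})"
definition open_endo :: "'a endo set \<Rightarrow> bool" where
  "open_endo S = (\<forall>x\<in>S. \<forall>\<^sub>F (x', y) in uniformity. x' = x \<longrightarrow> y \<in> S)"

instance
proof
  fix x y z :: "'a endo" and a b :: real
  show "(0::'a endo) \<noteq> 1"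
    by transfer (metis norm_blinfun_id norm_zero zero_neq_one)
  show "norm (1::'a endo) = 1" by transfer simp
  show "norm (x * y) \<le> norm x * norm y" by transfer (rule norm_blinfun_compose)
  show "x + y + z = x + (y + z)" by transfer simp
  show "x + y = y + x" by transfer simp
  show "0 + x = x" by transfer simp
  show "- x + x = 0" by transfer simp
  show "x - y = x + - y" by transfer simp
  show "a *\<^sub>R (x + y) = a *\<^sub>R x + a *\<^sub>R y" by transfer (rule scaleR_add_right)
  show "(a + b) *\<^sub>R x = a *\<^sub>R x + b *\<^sub>R x" by transfer (rule scaleR_add_left)
  show "a *\<^sub>R b *\<^sub>R x = (a * b) *\<^sub>R x" by transfer simp
  show "1 *\<^sub>R x = x" by transfer simp
  show "x * y * z = x * (y * z)" by transfer (simp add: blinfun_eqI)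
  show "(x + y) * z = x * z + y * z" by transfer (simp add: blinfun_eqI blinfun.bilinear_simps)
  show "x * (y + z) = x * y + x * z" by transfer (simp add: blinfun_eqI blinfun.bilinear_simps)
  show "1 * x = x" by transfer (simp add: blinfun_eqI)
  show "x * 1 = x" by transfer (simp add: blinfun_eqI)
  show "a *\<^sub>R x * y = a *\<^sub>R (x * y)" by transfer (simp add: blinfun_eqI blinfun.bilinear_simps)
  show "x * a *\<^sub>R y = a *\<^sub>R (x * y)" by transfer (simp add: blinfun_eqI blinfun.bilinear_simps)
  show "dist x y = norm (x - y)" by transfer (rule dist_norm)
  show "sgn x = inverse (norm x) *\<^sub>R x" by (rule sgn_endo_def)
  show "(norm x = 0) = (x = 0)" by transfer simp
  show "norm (x + y) \<le> norm x + norm y" by transfer (rule norm_triangle_ineq)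
  show "norm (a *\<^sub>R x) = \<bar>a\<bar> * norm x" by transfer simp
qed (simp_all add: uniformity_endo_def open_endo_def)

end

instance endo :: (finite) banach
proof
  fix X :: "nat \<Rightarrow> 'a endo"
  assume "Cauchy X"
  then have "Cauchy (\<lambda>n. blinfun_of_endo (X n))"
    by (simp add: Cauchy_def dist_endo.rep_eq)
  then obtain L where "(\<lambda>n. blinfun_of_endo (X n)) \<longlonglongrightarrow> L"
    by (meson Cauchy_convergent_iff convergent_def)
  then have "X \<longlonglongrightarrow> endo_of_blinfun L"
    by (simp add: tendsto_iff dist_endo.rep_eq endo_of_blinfun_inverse)
  then show "convergent X" by (auto simp: convergent_def)
qed

lemma endo_eqI:
  assumes "\<And>x. blinfun_apply (blinfun_of_endo f) x = blinfun_apply (blinfun_of_endo g) x"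
  shows "f = g"
  using assms by (metis blinfun_eqI blinfun_of_endo_inject)

section \<open>Matrices as endomorphisms, and the exponential in both guises\<close>

definition endo_of_matrix :: "real^'n^'n \<Rightarrow> 'n endo" where
  "endo_of_matrix A = endo_of_blinfun (Blinfun ((*v) A))"

definition matrix_of_endo :: "'n endo \<Rightarrow> real^'n^'n" where
  "matrix_of_endo f = matrix (blinfun_apply (blinfun_of_endo f))"

lemma blinfun_apply_endo_of_matrix [simp]:
  "blinfun_apply (blinfun_of_endo (endo_of_matrix A)) = (*v) A"
  by (simp add: endo_of_matrix_def endo_of_blinfun_inverse bounded_linear_Blinfun_apply
      matrix_vector_mul_bounded_linear)

lemma matrix_of_endo_inverse [simp]: "matrix_of_endo (endo_of_matrix A) = A"
  by (simp add: matrix_of_endo_def)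

lemma endo_of_matrix_inverse [simp]: "endo_of_matrix (matrix_of_endo f) = f"
proof -
  have "linear (blinfun_apply (blinfun_of_endo f))"
    by (simp add: blinfun.bounded_linear_right bounded_linear.linear)
  then have "blinfun_apply (blinfun_of_endo (endo_of_matrix (matrix_of_endo f))) = blinfun_apply (blinfun_of_endo f)"
    by (simp add: matrix_of_endo_def fun_eq_iff matrix_works)
  then show ?thesis
    by (intro endo_eqI) (metis)
qed

lemma endo_of_matrix_eq_iff [simp]: "endo_of_matrix A = endo_of_matrix B \<longleftrightarrow> A = B"
  by (metis matrix_of_endo_inverse)

lemma endo_of_matrix_mult: "endo_of_matrix (A ** B) = endo_of_matrix A * endo_of_matrix B"
  by (rule endo_eqI) (simp add: times_endo.rep_eq matrix_vector_mul_assoc)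

lemma endo_of_matrix_one [simp]: "endo_of_matrix (mat 1) = 1"
  by (rule endo_eqI) (simp add: one_endo.rep_eq)

lemma endo_of_matrix_zero [simp]: "endo_of_matrix 0 = 0"
  by (rule endo_eqI) (simp add: zero_endo.rep_eq)

lemma endo_of_matrix_add: "endo_of_matrix (A + B) = endo_of_matrix A + endo_of_matrix B"
  by (rule endo_eqI) (simp add: plus_endo.rep_eq blinfun.bilinear_simps matrix_vector_mult_add_rdistrib)

lemma endo_of_matrix_scaleR: "endo_of_matrix (c *\<^sub>R A) = c *\<^sub>R endo_of_matrix A"
  by (rule endo_eqI) (simp add: scaleR_endo.rep_eq blinfun.bilinear_simps scaleR_matrix_vector_assoc)

lemma matrix_of_endo_eqI: "f = endo_of_matrix A \<Longrightarrow> matrix_of_endo f = A"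
  by simp

lemma matrix_of_endo_mult: "matrix_of_endo (f * g) = matrix_of_endo f ** matrix_of_endo g"
  by (rule matrix_of_endo_eqI) (simp add: endo_of_matrix_mult)

text \<open>Column \<open>j\<close> is the image of a unit vector, so each entry is at most the
  operator norm. Continuity allows series and derivatives to be carried from endomorphisms to
  matrices.\<close>

lemma bounded_linear_matrix_of_endo: "bounded_linear (matrix_of_endo :: 'n::finite endo \<Rightarrow> _)"
proof (rule bounded_linear_intro)
  fix f g :: "'n endo" and r :: real
  show "matrix_of_endo (f + g) = matrix_of_endo f + matrix_of_endo g"
    by (rule matrix_of_endo_eqI) (simp add: endo_of_matrix_add)
  show "matrix_of_endo (r *\<^sub>R f) = r *\<^sub>R matrix_of_endo f"
    by (rule matrix_of_endo_eqI) (simp add: endo_of_matrix_scaleR)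
  have entry: "\<bar>matrix_of_endo f $ i $ j\<bar> \<le> norm f" for i j
  proof -
    have "\<bar>matrix_of_endo f $ i $ j\<bar> \<le> norm (blinfun_apply (blinfun_of_endo f) (axis j 1))"
      by (simp add: matrix_of_endo_def matrix_def component_le_norm_cart)
    also have "\<dots> \<le> norm f * norm (axis j (1::real))"
      unfolding norm_endo.rep_eq by (rule norm_blinfun)
    finally show ?thesis by simp
  qed
  have "norm (matrix_of_endo f) \<le> (\<Sum>i\<in>UNIV. norm (matrix_of_endo f $ i))"
    by (simp add: norm_vec_def L2_set_le_sum)
  also have "\<dots> \<le> (\<Sum>i\<in>(UNIV::'n set). \<Sum>j\<in>(UNIV::'n set). norm f)"
    by (intro sum_mono order_trans[OF norm_le_l1_cart] entry)
  finally show "norm (matrix_of_endo f) \<le> norm f * real (CARD('n) * CARD('n))"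
    by (simp add: mult_ac)
qed

lemma bounded_linear_endo_of_matrix: "bounded_linear endo_of_matrix"
  unfolding linear_conv_bounded_linear[symmetric]
  by (rule linearI) (simp_all add: endo_of_matrix_add endo_of_matrix_scaleR)

lemma endo_of_matrix_pow: "endo_of_matrix (matrix_pow A k) = endo_of_matrix A ^ k"
  by (induction k) (simp_all add: matrix_pow_def endo_of_matrix_mult)

text \<open>The exponential series converges in the Banach algebra, and a bounded linear map can be
  applied to it term by term.\<close>

lemma matrix_exp_eq: "matrix_exp A = matrix_of_endo (exp (endo_of_matrix A))"
proof -
  have "summable (\<lambda>k. endo_of_matrix A ^ k /\<^sub>R fact k)"
    by (rule summable_exp_generic)
  from bounded_linear.suminf[OF bounded_linear_matrix_of_endo this]
  have "matrix_of_endo (exp (endo_of_matrix A)) = (\<Sum>k. matrix_of_endo (endo_of_matrix A ^ k /\<^sub>R fact k))"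
    by (simp add: exp_def)
  also have "\<dots> = matrix_exp A"
    unfolding matrix_exp_def
    by (rule suminf_cong, rule matrix_of_endo_eqI)
       (simp add: endo_of_matrix_scaleR endo_of_matrix_pow inverse_eq_divide)
  finally show ?thesis ..
qed

lemma endo_of_matrix_exp: "endo_of_matrix (matrix_exp A) = exp (endo_of_matrix A)"
  by (simp add: matrix_exp_eq)

section \<open>Polynomials in an endomorphism and non-real eigenvalues\<close>

text \<open>One evaluation serves both endomorphisms and complex numbers, so that a polynomial in an
  endomorphism can be compared with its value at an eigenvalue.\<close>

definition peval :: "real poly \<Rightarrow> 'a::real_algebra_1 \<Rightarrow> 'a" where
  "peval p x = fold_coeffs (\<lambda>a b. of_real a + x * b) p 0"

lemma peval_0 [simp]: "peval 0 x = 0"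
  by (simp add: peval_def)

lemma peval_pCons [simp]: "peval (pCons a p) x = of_real a + x * peval p x"
  by (cases "p = 0 \<and> a = 0") (auto simp: peval_def)

lemma peval_add [simp]: "peval (p + q) x = peval p x + peval q x"
  by (induction p q rule: poly_induct2) (simp_all add: algebra_simps)

lemma peval_smult [simp]: "peval (Polynomial.smult c p) x = c *\<^sub>R peval p x"
  by (induction p) (simp_all add: scaleR_add_right, simp add: of_real_def)

lemma peval_minus [simp]: "peval (- p) x = - peval p x"
  using peval_smult[of "-1" p x] by simp

lemma peval_diff [simp]: "peval (p - q) x = peval p x - peval q x"
  using peval_add[of p "- q" x] by simp

lemma peval_one [simp]: "peval 1 x = 1"
  by (simp add: one_pCons)

lemma peval_mult [simp]: "peval (p * q) x = peval p x * peval q x"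
  by (induction p) (simp_all add: distrib_right mult.assoc scaleR_conv_of_real)

lemma peval_monom [simp]: "peval (monom c n) x = c *\<^sub>R x ^ n"
  by (induction n) (simp_all add: monom_0 monom_Suc, simp add: of_real_def)

lemma peval_sum [simp]: "peval (sum f S) x = (\<Sum>i\<in>S. peval (f i) x)"
  by (induction S rule: infinite_finite_induct) simp_all

lemma peval_eq_0_of_dvd: "p dvd f \<Longrightarrow> peval p x = 0 \<Longrightarrow> peval f x = 0"
  by (auto elim!: dvdE)

lemma peval_commute: "x * y = y * x \<Longrightarrow> peval p x * y = y * peval p x"
  by (induction p) (simp_all add: algebra_simps of_real_def, metis mult.assoc)

definition endo_apply :: "'n::finite endo \<Rightarrow> real^'n \<Rightarrow> real^'n" where
  "endo_apply f = blinfun_apply (blinfun_of_endo f)"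

lemma endo_apply_simps [simp]:
  "endo_apply 0 v = 0" "endo_apply 1 v = v"
  "endo_apply (f + g) v = endo_apply f v + endo_apply g v"
  "endo_apply (f - g) v = endo_apply f v - endo_apply g v"
  "endo_apply (f * g) v = endo_apply f (endo_apply g v)"
  "endo_apply (c *\<^sub>R f) v = c *\<^sub>R endo_apply f v"
  "endo_apply f (v + w) = endo_apply f v + endo_apply f w"
  "endo_apply f (v - w) = endo_apply f v - endo_apply f w"
  "endo_apply f (c *\<^sub>R v) = c *\<^sub>R endo_apply f v"
  "endo_apply f (- v) = - endo_apply f v"
  "endo_apply (of_real c) v = c *\<^sub>R v"
  by (simp_all add: endo_apply_def zero_endo.rep_eq one_endo.rep_eq plus_endo.rep_eq
      minus_endo.rep_eq times_endo.rep_eq scaleR_endo.rep_eq blinfun.bilinear_simps of_real_def)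

lemma endo_apply_endo_of_matrix [simp]: "endo_apply (endo_of_matrix A) v = A *v v"
  by (simp add: endo_apply_def)

text \<open>The powers with exponents \<open>0\<close> to \<open>N\<close> are \<open>N + 1\<close>
  elements of an \<open>N\<close>-dimensional space; a linear relation between them is the
  polynomial.\<close>

lemma annihilating_poly_exists:
  fixes A :: "'n::finite endo"
  obtains p where "p \<noteq> 0" "peval p A = 0"
proof -
  define N where "N = DIM(real^'n^'n)"
  let ?f = "\<lambda>i. matrix_of_endo (A ^ i)"
  note lin = bounded_linear.linear[OF bounded_linear_matrix_of_endo]
  show ?thesis
  proof (cases "inj_on ?f {..N}")
    \<comment> \<open>Dependence is a property of sets and does not see repetitions, so two equal
      powers are treated apart.\<close>
    case False
    then obtain i j where "i \<noteq> j" "?f i = ?f j" by (auto simp: inj_on_def)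
    then have "A ^ i = A ^ j" by (metis endo_of_matrix_inverse)
    moreover have "monom 1 i - monom 1 j \<noteq> (0 :: real poly)"
      using \<open>i \<noteq> j\<close> by (metis eq_iff_diff_eq_0 monom_eq_iff' zero_neq_one)
    ultimately show ?thesis
      by (intro that[of "monom 1 i - monom 1 j"]) simp_all
  next
    case True
    then have "dependent (?f ` {..N})"
      by (intro dependent_biggerset) (simp add: card_image N_def)
    then obtain u where u: "\<exists>v\<in>?f ` {..N}. u v \<noteq> 0" "(\<Sum>v\<in>?f ` {..N}. u v *\<^sub>R v) = 0"
      by (subst (asm) dependent_finite) auto
    let ?p = "\<Sum>i\<le>N. monom (u (?f i)) i"
    have "coeff ?p i = u (?f i)" if "i \<le> N" for i
      using that by (simp add: coeff_sum)
    with u(1) have "?p \<noteq> 0" by force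
    moreover have "matrix_of_endo (peval ?p A) = (\<Sum>i\<le>N. u (?f i) *\<^sub>R ?f i)"
      by (simp add: linear_sum[OF lin] linear_scale[OF lin])
    then have "matrix_of_endo (peval ?p A) = 0"
      using u(2) True by (simp add: sum.reindex)
    then have "peval ?p A = 0"
      using endo_of_matrix_inverse[of "peval ?p A"] by simp
    ultimately show ?thesis by (rule that)
  qed
qed

text \<open>The two assumptions are the real and imaginary parts of
  \<open>A (x + iy) = (a + ib) (x + iy)\<close>. The conclusion is the same for \<open>p(A)\<close>
  and the eigenvalue \<open>p(a + ib)\<close>, avoiding a complexified space.\<close>

lemma endo_apply_peval_eigenpair:
  fixes A :: "'n::finite endo"
  assumes "endo_apply A x = a *\<^sub>R x - b *\<^sub>R y" "endo_apply A y = b *\<^sub>R x + a *\<^sub>R y"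
  defines "z \<equiv> \<lambda>p. peval p (Complex a b)"
  shows "endo_apply (peval p A) x = Re (z p) *\<^sub>R x - Im (z p) *\<^sub>R y \<and>
         endo_apply (peval p A) y = Im (z p) *\<^sub>R x + Re (z p) *\<^sub>R y"
proof (induction p)
  case 0
  show ?case by (simp add: z_def)
next
  case (pCons c p)
  have "z (pCons c p) = of_real c + Complex a b * z p"
    by (simp add: z_def)
  moreover have "endo_apply (peval p A) x = Re (z p) *\<^sub>R x - Im (z p) *\<^sub>R y"
    and "endo_apply (peval p A) y = Im (z p) *\<^sub>R x + Re (z p) *\<^sub>R y"
    using pCons.IH by auto
  ultimately show ?case
    by (simp add: assms(1,2) scaleR_add_left scaleR_diff_left scaleR_add_right scaleR_diff_right mult.commute)
qed

lemma poly_eigenvalue_eq_0: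
  fixes A :: "'n::finite endo"
  assumes "endo_apply A x = a *\<^sub>R x - b *\<^sub>R y" "endo_apply A y = b *\<^sub>R x + a *\<^sub>R y"
    and "x \<noteq> 0 \<or> y \<noteq> 0" "peval p A = 0"
  shows "peval p (Complex a b) = 0"
proof -
  define c d where "c = Re (peval p (Complex a b))"
    and "d = Im (peval p (Complex a b))"
  have e: "c *\<^sub>R x = d *\<^sub>R y" "d *\<^sub>R x = - (c *\<^sub>R y)"
    using endo_apply_peval_eigenpair[OF assms(1,2), of p] assms(4)
    by (simp_all add: c_def d_def eq_neg_iff_add_eq_0)
  \<comment> \<open>The vector \<open>(c + id) (x + iy)\<close> vanishes; multiplying it by the
    conjugate \<open>c - id\<close> isolates \<open>x\<close> and \<open>y\<close>.\<close>
  have "(c * c + d * d) *\<^sub>R x = c *\<^sub>R (c *\<^sub>R x) + d *\<^sub>R (d *\<^sub>R x)"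
    by (simp add: algebra_simps)
  also have "\<dots> = 0" by (simp add: e)
  finally have "c * c + d * d = 0 \<or> x = 0" by simp
  moreover have "(c * c + d * d) *\<^sub>R y = d *\<^sub>R (d *\<^sub>R y) - c *\<^sub>R (- (c *\<^sub>R y))"
    by (simp add: algebra_simps)
  then have "(c * c + d * d) *\<^sub>R y = 0" by (simp flip: e add: mult.commute)
  ultimately have "c = 0 \<and> d = 0" using assms(3) by (auto simp: sum_squares_eq_zero_iff)
  then show ?thesis by (simp add: c_def d_def complex_eq_iff)
qed

text \<open>A proper factor of a quadratic is linear and would give a real root. Primality then
  turns non-divisibility by this polynomial into coprimality.\<close>

lemma prime_elem_x2_plus_1: "prime_elem [:1, 0, 1 :: real:]"
proof -
  have noroot: "poly [:1, 0, 1 :: real:] t \<noteq> 0" for t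
    using zero_le_square[of t] by (simp add: add_nonneg_eq_0_iff)
  have lin: False if eq: "[:1, 0, 1 :: real:] = a * b" and deg: "degree a = 1" for a b
  proof -
    obtain c d where a: "a = [:c, d:]" "d \<noteq> 0"
      using deg by (metis degree1_coeffs)
    then have "poly a (- c / d) = 0" by simp
    then show False using noroot[of "- c / d"] eq by (metis poly_mult mult_zero_left)
  qed
  have "irreducible [:1, 0, 1 :: real:]"
  proof (rule irreducibleI)
    fix a b :: "real poly" assume ab: "[:1, 0, 1:] = a * b"
    then have nz: "a \<noteq> 0" "b \<noteq> 0" by auto
    then have "degree a + degree b = 2"
      using arg_cong[OF ab, of degree] by (simp add: degree_mult_eq)
    moreover have "degree a \<noteq> 1" using lin ab by blast
    ultimately have "degree a = 0 \<or> degree b = 0" by linarith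
    then show "is_unit a \<or> is_unit b" using nz by (simp add: is_unit_iff_degree)
  qed (simp_all add: is_unit_iff_degree)
  then show ?thesis by (simp add: irreducible_imp_prime_elem_gcd)
qed

text \<open>Hensel lifting: one Newton step squares the error \<open>h\<^sup>2 + 1\<close>.\<close>

lemma sqrt_minus_one_mod_x2_plus_1_power:
  "\<exists>h. [:1, 0, 1 :: real:] ^ Suc k dvd h\<^sup>2 + 1"
proof (induction k)
  case 0
  show ?case by (rule exI[of _ "[:0, 1:]"]) (simp add: power2_eq_square one_pCons)
next
  case (Suc k)
  then obtain h where h: "[:1, 0, 1 :: real:] ^ Suc k dvd h\<^sup>2 + 1" by blast
  define e c where "e = h\<^sup>2 + 1" and "c = [:1/2 :: real:]"
  have c: "2 * c = 1" by (simp add: c_def one_pCons numeral_poly)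
  \<comment> \<open>This is the Newton step \<open>h - e/(2h)\<close> for
    \<open>h\<^sup>2 = -1\<close>, with \<open>1/h\<close> replaced by \<open>-h\<close>, its
    inverse modulo \<open>e\<close>.\<close>
  have "(h * (1 + c * e))\<^sup>2 + 1 = e\<^sup>2 * (1 + c\<^sup>2 * e - c\<^sup>2)"
  proof -
    have "(h * (1 + c * e))\<^sup>2 + 1 = h\<^sup>2 * (1 + (2 * c) * e + c\<^sup>2 * e\<^sup>2) + 1"
      by (simp add: power2_eq_square algebra_simps)
    also have "\<dots> = (e - 1) * (1 + e + c\<^sup>2 * e\<^sup>2) + 1"
      by (simp only: c) (simp add: e_def)
    also have "\<dots> = e\<^sup>2 * (1 + c\<^sup>2 * e - c\<^sup>2)"
      by (simp add: power2_eq_square algebra_simps)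
    finally show ?thesis .
  qed
  moreover have "[:1, 0, 1 :: real:] ^ Suc (Suc k) dvd e\<^sup>2"
  proof -
    have "[:1, 0, 1 :: real:] ^ Suc k * [:1, 0, 1 :: real:] ^ Suc k dvd e * e"
      using h unfolding e_def by (rule mult_dvd_mono) (rule h)
    moreover have "[:1, 0, 1 :: real:] ^ Suc (Suc k) dvd [:1, 0, 1 :: real:] ^ Suc k * [:1, 0, 1 :: real:] ^ Suc k"
      unfolding power_add[symmetric] by (rule le_imp_power_dvd) simp
    ultimately show ?thesis unfolding power2_eq_square by (rule dvd_trans[rotated])
  qed
  ultimately show ?case by (metis dvd_mult2)
qed

text \<open>
  \<open>u(A)\<close> is the projection onto the generalized eigenspace of \<open>\<plusminus>i\<close>, on which \<open>h(A)\<close> squares to \<open>-1\<close>.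
\<close>

lemma partial_complex_structure_of_eigenvalue_i:
  fixes A :: "'n::finite endo"
  assumes "endo_apply A x = - y" "endo_apply A y = x" and "x \<noteq> 0 \<or> y \<noteq> 0"
  obtains f where "peval f A \<noteq> 0" "peval f A * peval f A * peval f A = - peval f A"
proof -
  define q where "q = [:1, 0, 1 :: real:]"
  obtain p where p: "p \<noteq> 0" "peval p A = 0" by (rule annihilating_poly_exists)
  \<comment> \<open>\<open>q ^ m\<close> is the exact power of \<open>q\<close> in the annihilating
    polynomial, which makes the cofactor \<open>r\<close> coprime to \<open>q\<close>.\<close>
  obtain m r where pqr: "p = q ^ m * r" "\<not> q dvd r"
    using multiplicity_decompose'[of p q] p(1) prime_elem_x2_plus_1
    by (metis prime_elem_not_unit q_def)
  then have "coprime q r"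
    using prime_elem_imp_coprime[OF prime_elem_x2_plus_1] by (simp add: q_def)
  then have "coprime (q ^ Suc m) r" by (rule coprime_power_left_iff[THEN iffD2, OF disjI1])
  then obtain a b where ab: "a * q ^ Suc m + b * r = 1"
    by (metis bezout_coefficients_fst_snd coprime_imp_gcd_eq_1)
  \<comment> \<open>The exponent \<open>Suc m\<close> is positive in any case, so divisibility by
    this power yields a zero at \<open>\<i>\<close> without a proof that
    \<open>m > 0\<close>.\<close>
  obtain h where h: "q ^ Suc m dvd h\<^sup>2 + 1"
    using sqrt_minus_one_mod_x2_plus_1_power[of m] by (auto simp: q_def)
  \<comment> \<open>By the Bezout identity \<open>u\<close> is 1 modulo \<open>q ^ Suc m\<close> and
    0 modulo \<open>r\<close>.\<close>
  define u f where "u = b * r" and "f = u * h"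
  have u1: "q ^ Suc m dvd 1 - u" unfolding u_def ab[symmetric] by simp
  have "q ^ Suc m dvd u\<^sup>2 * (h\<^sup>2 + 1) + (1 - u) * (1 + u)"
    by (rule dvd_add[OF dvd_mult[OF h] dvd_mult2[OF u1]])
  also have "u\<^sup>2 * (h\<^sup>2 + 1) + (1 - u) * (1 + u) = u\<^sup>2 * h\<^sup>2 + 1"
    by (simp add: algebra_simps power2_eq_square)
  finally have "q ^ m dvd u\<^sup>2 * h\<^sup>2 + 1"
    by (meson dvd_trans le_imp_power_dvd le_SucI order_refl)
  \<comment> \<open>The first factor absorbs \<open>q ^ m\<close>, and the second absorbs
    \<open>r\<close> through \<open>u\<close>.\<close>
  then have "p dvd (u\<^sup>2 * h\<^sup>2 + 1) * (u * h)"
    unfolding pqr(1) by (rule mult_dvd_mono) (simp add: u_def)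
  also have "(u\<^sup>2 * h\<^sup>2 + 1) * (u * h) = f * f * f + f"
    by (simp add: f_def algebra_simps power2_eq_square)
  finally have "peval (f * f * f + f) A = 0"
    using p(2) peval_eq_0_of_dvd by blast
  then have "peval f A * peval f A * peval f A = - peval f A"
    by (simp add: eq_neg_iff_add_eq_0)
  moreover have "peval f A \<noteq> 0"
  proof
    assume "peval f A = 0"
    \<comment> \<open>If \<open>f\<close> annihilated \<open>A\<close>, it would vanish at the
      eigenvalue \<open>\<i>\<close>; but there \<open>u\<close> is 1 and \<open>h\<close> squares
      to -1.\<close>
    let ?z = "\<lambda>p. peval p \<i>"
    have "?z f = 0"
      using poly_eigenvalue_eq_0[of A x 0 1 y f] assms \<open>peval f A = 0\<close>
      by (simp add: imaginary_unit.code)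
    have zq: "?z w = 0" if "q ^ Suc m dvd w" for w
    proof -
      obtain v where "w = q * v" using \<open>q ^ Suc m dvd w\<close> by (metis dvdE power_Suc mult.assoc)
      moreover have "?z q = 0" by (simp add: q_def)
      ultimately show ?thesis by simp
    qed
    have "?z (u * h) = 0" using \<open>?z f = 0\<close> by (simp add: f_def)
    moreover have "?z u = 1"
      using zq[OF u1] by simp
    moreover have "?z h * ?z h = - 1"
      using zq[OF h] by (simp add: power2_eq_square eq_neg_iff_add_eq_0)
    ultimately show False by simp
  qed
  ultimately show ?thesis using that by blast
qed

text \<open>Shifting by \<open>a\<close> and dividing by \<open>b\<close> moves the eigenvalue to
  \<open>\<i>\<close>. The resulting \<open>J\<close> is a polynomial in \<open>A\<close>, hence
  commutes with everything that commutes with \<open>A\<close>.\<close>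

lemma partial_complex_structure_of_nonreal_eigenvalue:
  fixes A :: "'n::finite endo"
  assumes "endo_apply A x = a *\<^sub>R x - b *\<^sub>R y" "endo_apply A y = b *\<^sub>R x + a *\<^sub>R y"
    and "b \<noteq> 0" "x \<noteq> 0 \<or> y \<noteq> 0"
  obtains J where "J \<noteq> 0" "J * J * J = - J" "\<And>B. A * B = B * A \<Longrightarrow> J * B = B * J"
proof -
  define A' where "A' = (1 / b) *\<^sub>R (A - of_real a)"
  have "endo_apply A' x = - y" "endo_apply A' y = x"
    using assms by (simp_all add: A'_def)
  then obtain f where f: "peval f A' \<noteq> 0" "peval f A' * peval f A' * peval f A' = - peval f A'"
    using assms(4) by (rule partial_complex_structure_of_eigenvalue_i)
  have "peval f A' * B = B * peval f A'" if "A * B = B * A" for B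
    using that by (intro peval_commute) (simp add: A'_def algebra_simps of_real_def)
  with f show ?thesis by (rule that)
qed

section \<open>Unique logarithms\<close>

lemma exp_conj:
  fixes P Q Y :: "'a::{real_normed_algebra_1,banach}"
  assumes "P * Q = 1" "Q * P = 1"
  shows "exp (P * Y * Q) = P * exp Y * Q"
proof -
  have pow: "(P * Y * Q) ^ k = P * Y ^ k * Q" for k
  proof (induction k)
    case (Suc k)
    have "(P * Y * Q) ^ Suc k = (P * Y * Q) * (P * Y ^ k * Q)" by (simp only: power_Suc Suc)
    also have "\<dots> = P * Y * (Q * P) * Y ^ k * Q" by (simp only: mult.assoc)
    finally have "(P * Y * Q) ^ Suc k = P * Y * (Q * P) * Y ^ k * Q" .
    then show ?case by (simp add: assms mult.assoc)
  qed (simp add: assms)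
  have "bounded_linear (\<lambda>x. P * x * Q)"
    using bounded_linear_compose[OF bounded_linear_mult_left bounded_linear_mult_right] .
  from bounded_linear.suminf[OF this summable_exp_generic[of Y]]
  show ?thesis by (simp add: exp_def pow)
qed

text \<open>Rodrigues' formula: \<open>F t\<close> is the closed form of \<open>exp(tJ)\<close>. It
  satisfies \<open>F' = J F\<close>, so \<open>exp(-tJ) F t\<close> is constant, and
  \<open>F\<close> takes the value 1 at both 0 and \<open>2 * pi\<close>.\<close>

lemma exp_2pi_partial_complex_structure:
  fixes J :: "'a::{real_normed_algebra_1,banach}"
  assumes "J * J * J = - J"
  shows "exp ((2 * pi) *\<^sub>R J) = 1"
proof -
  define F where "F t = 1 + sin t *\<^sub>R J + (1 - cos t) *\<^sub>R (J * J)" for t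
  define G where "G t = exp (t *\<^sub>R (- J)) * F t" for t
  have "(F has_vector_derivative cos t *\<^sub>R J + sin t *\<^sub>R (J * J)) (at t)" for t
    unfolding F_def by (auto intro!: derivative_eq_intros)
  moreover have "((\<lambda>t. exp (t *\<^sub>R (- J))) has_vector_derivative exp (t *\<^sub>R (- J)) * (- J)) (at t)" for t
    by (rule exp_scaleR_has_vector_derivative_right)
  ultimately have "(G has_vector_derivative
      exp (t *\<^sub>R (- J)) * (cos t *\<^sub>R J + sin t *\<^sub>R (J * J)) + exp (t *\<^sub>R (- J)) * (- J) * F t) (at t)" for t
    unfolding G_def by (intro has_vector_derivative_mult)
  moreover have "J * F t = cos t *\<^sub>R J + sin t *\<^sub>R (J * J)" for t
    using assms by (simp add: F_def algebra_simps flip: mult.assoc)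
  then have "exp (t *\<^sub>R (- J)) * (cos t *\<^sub>R J + sin t *\<^sub>R (J * J)) + exp (t *\<^sub>R (- J)) * (- J) * F t = 0" for t
    by (simp add: mult.assoc)
  ultimately have "(G has_vector_derivative 0) (at t within UNIV)" for t by simp
  then obtain c where "\<And>t. G t = c"
    using has_vector_derivative_zero_constant[of UNIV G] by auto
  then have "G (2 * pi) = G 0" by simp
  then have "exp (- ((2 * pi) *\<^sub>R J)) = 1" by (simp add: G_def F_def)
  with exp_minus_inverse[of "(2 * pi) *\<^sub>R J"] show ?thesis by simp
qed

text \<open>
  The inverse of \<open>1 + J\<close> is \<open>1 - J/2 + J\<^sup>2/2\<close>. Conjugation by \<open>1 + J\<close> fixes \<open>exp Y\<close>, hence its
  only logarithm \<open>Y\<close>, so that \<open>Y + 2\<pi>J\<close> is again a logarithm.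
\<close>

lemma no_partial_complex_structure_of_unique_log:
  fixes Y J :: "'a::{real_normed_algebra_1,banach}"
  assumes unique: "\<And>Z. exp Z = exp Y \<Longrightarrow> Z = Y"
    and J: "J * J * J = - J" "J * exp Y = exp Y * J"
  shows "J = 0"
proof -
  define P Q where "P = 1 + J" and "Q = 1 - (1/2) *\<^sub>R J + (1/2) *\<^sub>R (J * J)"
  have "J = (1/2) *\<^sub>R J + (1/2) *\<^sub>R J" by (metis field_sum_of_halves scaleR_add_left scaleR_one)
  moreover have J3: "J * (J * J) = - J" using J(1) by (simp add: mult.assoc)
  ultimately have PQ: "P * Q = 1" "Q * P = 1"
    by (simp_all add: P_def Q_def algebra_simps)
  have "exp (P * Y * Q) = P * exp Y * Q" using PQ by (rule exp_conj)
  also have "P * exp Y = exp Y * P" by (simp add: P_def algebra_simps J(2))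
  also have "exp Y * P * Q = exp Y" by (simp add: mult.assoc PQ)
  finally have "P * Y * Q = Y" by (rule unique)
  then have "P * Y * (Q * P) = Y * P" by (metis mult.assoc)
  then have "P * Y = Y * P" by (simp add: PQ)
  then have "J * Y = Y * J" by (simp add: P_def algebra_simps)
  then have "exp (Y + (2 * pi) *\<^sub>R J) = exp Y * exp ((2 * pi) *\<^sub>R J)"
    by (intro exp_add_commuting) simp
  also have "\<dots> = exp Y" using exp_2pi_partial_complex_structure[OF J(1)] by simp
  finally show "J = 0" using unique by fastforce
qed

text \<open>A non-real eigenvalue of \<open>exp Y\<close> yields a forbidden \<open>J\<close>
  directly. A negative one does so through the square root \<open>exp (Y/2)\<close>, and 0 is
  excluded by invertibility.\<close>

lemma eigenpair_exp_unique_log: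
  fixes Y :: "'n::finite endo"
  assumes unique: "\<And>Z. exp Z = exp Y \<Longrightarrow> Z = Y"
    and eig: "endo_apply (exp Y) x = a *\<^sub>R x - b *\<^sub>R y" "endo_apply (exp Y) y = b *\<^sub>R x + a *\<^sub>R y"
    and nz: "x \<noteq> 0 \<or> y \<noteq> 0"
  shows "b = 0" "a > 0"
proof -
  note noJ = no_partial_complex_structure_of_unique_log[OF unique]
  show "b = 0"
  proof (rule ccontr)
    assume "b \<noteq> 0"
    obtain J where "J \<noteq> 0" "J * J * J = - J" "\<And>B. exp Y * B = B * exp Y \<Longrightarrow> J * B = B * J"
      using partial_complex_structure_of_nonreal_eigenvalue[OF eig \<open>b \<noteq> 0\<close> nz] by blast
    then show False using noJ by blast
  qed
  with eig nz obtain v where v: "v \<noteq> 0" "endo_apply (exp Y) v = a *\<^sub>R v" by auto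
  show "a > 0"
  proof (rule ccontr)
    assume "\<not> a > 0"
    have "endo_apply (exp (- Y)) (endo_apply (exp Y) v) = v"
      using exp_minus_inverse[of "- Y"] by (simp flip: endo_apply_simps(5))
    then have "a \<noteq> 0" using v by auto
    with \<open>\<not> a > 0\<close> have "a < 0" by simp
    define c S where "c = sqrt (- a)" and "S = exp ((1/2) *\<^sub>R Y)"
    have c: "c \<noteq> 0" "c * c = - a" using \<open>a < 0\<close> by (simp_all add: c_def)
    have SS: "S * S = exp Y"
      unfolding S_def by (subst exp_add_commuting[symmetric]) (simp_all flip: scaleR_add_left)
    then have SSv: "endo_apply S (endo_apply S v) = a *\<^sub>R v" using v(2) by (metis endo_apply_simps(5))
    \<comment> \<open>On the span of \<open>v\<close> and \<open>w\<close>, \<open>S\<close> acts as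
      a quarter turn scaled by \<open>c\<close>: the pair represents the eigenvalue
      \<open>ic\<close> of \<open>S\<close>.\<close>
    define w where "w = (- 1 / c) *\<^sub>R endo_apply S v"
    have Sv: "endo_apply S v = 0 *\<^sub>R v - c *\<^sub>R w" "endo_apply S w = c *\<^sub>R v + 0 *\<^sub>R w"
      using c by (simp_all add: w_def SSv eq_neg_iff_add_eq_0 field_simps flip: scaleR_minus_left)
    obtain J where J: "J \<noteq> 0" "J * J * J = - J" "\<And>B. S * B = B * S \<Longrightarrow> J * B = B * J"
      using partial_complex_structure_of_nonreal_eigenvalue[OF Sv c(1)] v(1) by blast
    have "J * exp Y = exp Y * J" by (rule J(3)) (simp add: SS[symmetric] mult.assoc)
    with J noJ show False by blast
  qed
qed

section \<open>Jordan normal form\<close>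

text \<open>Splitting the block list around one block exhibits the matrix as nested block-diagonal
  matrices. Here \<open>o1\<close> is the offset at which the chosen block starts.\<close>

lemma jordan_matrix_block_entries:
  fixes as cs :: "(nat \<times> real) list" and k :: nat and r :: real
  defines "o1 \<equiv> sum_list (map fst as)" and "D \<equiv> jordan_matrix (as @ (k, r) # cs)"
  assumes i: "i \<in> {o1..<o1 + k}" and j: "j < o1 + k + sum_list (map fst cs)"
  shows "D $$ (i, j) = (if j \<in> {o1..<o1 + k} then jordan_block k r $$ (i - o1, j - o1) else 0)"
    and "D $$ (j, i) = (if j \<in> {o1..<o1 + k} then jordan_block k r $$ (j - o1, i - o1) else 0)"
proof -
  have "D = (let A = jordan_matrix as; B = jordan_matrix ((k, r) # cs)
      in four_block_mat A (0\<^sub>m (dim_row A) (dim_col B)) (0\<^sub>m (dim_row B) (dim_col A)) B)"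
    unfolding D_def jordan_matrix_def map_append by (rule diag_block_mat_append)
  then have D: "D = four_block_mat (jordan_matrix as)
       (0\<^sub>m o1 (k + sum_list (map fst cs))) (0\<^sub>m (k + sum_list (map fst cs)) o1)
       (four_block_mat (jordan_block k r) (0\<^sub>m k (sum_list (map fst cs)))
         (0\<^sub>m (sum_list (map fst cs)) k) (jordan_matrix cs))"
    by (simp add: Let_def o1_def jordan_matrix_Cons)
  show "D $$ (i, j) = (if j \<in> {o1..<o1 + k} then jordan_block k r $$ (i - o1, j - o1) else 0)"
    and "D $$ (j, i) = (if j \<in> {o1..<o1 + k} then jordan_block k r $$ (j - o1, i - o1) else 0)"
    using i j unfolding D by (auto simp: o1_def[symmetric])
qed

text \<open>
  Swapping two equal Jordan blocks, with the sign \<open>-1\<close> on one of them, is a rotation that commutes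
  with the Jordan matrix.
\<close>

lemma partial_complex_structure_of_repeated_jordan_block:
  fixes bs :: "(nat \<times> real) list"
  assumes "\<not> distinct bs" "0 \<notin> fst ` set bs" and N: "sum_list (map fst bs) = CARD('n::finite)"
  obtains J :: "real^'n^'n" where "J \<noteq> 0" "J ** J ** J = - J"
    "J ** from_nat_indexed (jordan_matrix bs) = from_nat_indexed (jordan_matrix bs) ** J"
proof -
  from \<open>\<not> distinct bs\<close> obtain as cs ds k r
    where bs: "bs = as @ [(k, r)] @ cs @ [(k, r)] @ ds"
    by (metis not_distinct_decomp surj_pair)
  have k: "k > 0" using assms(2) by (auto simp: bs)
  let ?D = "jordan_matrix bs"
  define p q where "p = sum_list (map fst as)" and "q = p + k + sum_list (map fst cs)"
  have qn: "q + k \<le> CARD('n)" and pq: "p + k \<le> q"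
    using N by (simp_all add: p_def q_def bs)
  define I1 I2 where "I1 = {p..<p + k}" and "I2 = {q..<q + k}"
  have D1: "?D $$ (i, j) = (if j \<in> I1 then jordan_block k r $$ (i - p, j - p) else 0)"
       "?D $$ (j, i) = (if j \<in> I1 then jordan_block k r $$ (j - p, i - p) else 0)"
    if "i \<in> I1" "j < CARD('n)" for i j
    using jordan_matrix_block_entries[of i as k j "cs @ [(k, r)] @ ds" r] that N
    by (simp_all add: I1_def p_def bs)
  have D2: "?D $$ (i, j) = (if j \<in> I2 then jordan_block k r $$ (i - q, j - q) else 0)"
       "?D $$ (j, i) = (if j \<in> I2 then jordan_block k r $$ (j - q, i - q) else 0)"
    if "i \<in> I2" "j < CARD('n)" for i j
    using jordan_matrix_block_entries[of i "as @ [(k, r)] @ cs" k j ds r] that N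
    by (simp_all add: I2_def p_def q_def bs add.assoc)
  \<comment> \<open>\<open>\<tau>\<close> exchanges the two blocks position by position, and
    \<open>s\<close> is the sign attached to each row. The value 0 elsewhere makes the rotation
    vanish off the two blocks.\<close>
  define s :: "nat \<Rightarrow> real" where "s i = (if i \<in> I1 then 1 else if i \<in> I2 then - 1 else 0)" for i
  define \<tau> where "\<tau> i = (if i \<in> I1 then i - p + q else if i \<in> I2 then i - q + p else i)" for i
  have disj: "\<not> (i \<in> I1 \<and> i \<in> I2)" for i using pq by (auto simp: I1_def I2_def)
  have \<tau>: "\<tau> (\<tau> i) = i" "s (\<tau> i) = - s i" "i < CARD('n) \<Longrightarrow> \<tau> i < CARD('n)" for i
    using pq qn by (auto simp: \<tau>_def s_def I1_def I2_def)
  have \<tau>12: "i \<in> I1 \<Longrightarrow> \<tau> i \<in> I2 \<and> \<tau> i - q = i - p" "i \<in> I2 \<Longrightarrow> \<tau> i \<in> I1 \<and> \<tau> i - p = i - q"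
     "i \<notin> I1 \<Longrightarrow> i \<notin> I2 \<Longrightarrow> \<tau> i = i" "\<tau> i \<in> I1 \<longleftrightarrow> i \<in> I2" "\<tau> i \<in> I2 \<longleftrightarrow> i \<in> I1" for i
    using pq by (auto simp: \<tau>_def I1_def I2_def)
  have \<tau>D: "?D $$ (\<tau> i, \<tau> j) = ?D $$ (i, j)" if ij: "i < CARD('n)" "j < CARD('n)" for i j
  proof -
    note lt = ij \<tau>(3)[OF ij(1)] \<tau>(3)[OF ij(2)]
    consider "i \<in> I1" | "i \<in> I2" | "i \<notin> I1" "i \<notin> I2" "j \<in> I1" | "i \<notin> I1" "i \<notin> I2" "j \<in> I2"
      | "i \<notin> I1" "i \<notin> I2" "j \<notin> I1" "j \<notin> I2" by blast
    then show ?thesis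
      by cases (use lt \<tau>12[of i] \<tau>12[of j] disj in \<open>auto simp: D1 D2\<close>)
  qed
  \<comment> \<open>\<open>s\<close> is constant on each of the two blocks, and an entry joining an
    index of such a block to one outside it is zero.\<close>
  have sD: "s i * ?D $$ (i, j) = s j * ?D $$ (i, j)" if ij: "i < CARD('n)" "j < CARD('n)" for i j
    using D1[OF _ ij(1), of j] D1[OF _ ij(2), of i] D2[OF _ ij(1), of j] D2[OF _ ij(2), of i]
    by (auto simp: s_def)
  let ?e = "to_nat_on (UNIV :: 'n set)"
  have e: "bij_betw ?e UNIV {..<CARD('n)}" by (simp add: to_nat_on_finite)
  then have elt: "?e i < CARD('n)" for i by (auto simp: bij_betw_def)
  \<comment> \<open>The involution \<open>\<tau>\<close> carried over to the index type
    \<open>'n\<close> along its enumeration.\<close>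
  define t where "t i = inv_into UNIV ?e (\<tau> (?e i))" for i
  have et: "?e (t i) = \<tau> (?e i)" for i
    unfolding t_def using e \<tau>(3)[OF elt, of i] by (intro f_inv_into_f) (simp add: bij_betw_def)
  have tt: "t (t i) = i" for i
    using e et \<tau>(1) by (metis bij_betw_def injD)
  define J :: "real^'n^'n" where "J = (\<chi> i j. if j = t i then s (?e i) else 0)"
  have JM: "(J ** M) $ i $ j = s (?e i) * M $ t i $ j" for M :: "real^'n^'n" and i j
    by (simp add: J_def matrix_matrix_mult_def if_distrib[of "\<lambda>x. x * _"] cong: if_cong)
  have MJ: "(M ** J) $ i $ j = M $ i $ t j * s (?e (t j))" for M :: "real^'n^'n" and i j
  proof -
    have "(j = t l) = (l = t j)" for l using tt by metis
    then show ?thesis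
      by (simp add: J_def matrix_matrix_mult_def if_distrib[of "\<lambda>x. _ * x"] cong: if_cong)
  qed
  show ?thesis
  proof (rule that)
    have "p < CARD('n)" "s p = 1" using qn pq k by (auto simp: s_def I1_def)
    then obtain i where i: "?e i = p" using e by (metis bij_betw_def imageE lessThan_iff)
    then have "J $ i $ t i = 1" using \<open>s p = 1\<close> by (simp add: J_def)
    then show "J \<noteq> 0" by auto
    show "J ** J ** J = - J"
      by (simp add: vec_eq_iff JM matrix_mul_assoc[symmetric] et \<tau> tt)
         (auto simp: J_def tt s_def)
    show "J ** from_nat_indexed ?D = from_nat_indexed ?D ** J"
    proof (simp add: vec_eq_iff JM MJ, intro allI)
      fix i j
      \<comment> \<open>The involution passes from the row index to the column index; the sign then
        follows it by \<open>sD\<close>.\<close>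
      have "s (?e i) * ?D $$ (\<tau> (?e i), ?e j) = s (?e i) * ?D $$ (?e i, \<tau> (?e j))"
        using \<tau>D[OF elt \<tau>(3)[OF elt], of i j] by (simp add: \<tau>)
      also have "\<dots> = s (\<tau> (?e j)) * ?D $$ (?e i, \<tau> (?e j))"
        by (rule sD) (simp_all add: elt \<tau>)
      finally show "s (?e i) * from_nat_indexed ?D $ t i $ j = from_nat_indexed ?D $ i $ t j * s (?e (t j))"
        by (simp add: from_nat_indexed_def et)
    qed
  qed
qed

section \<open>Passing between the two kinds of matrices\<close>

definition to_nat_indexed :: "real^'n^'n \<Rightarrow> real Matrix.mat" where
  "to_nat_indexed A = Matrix.mat CARD('n) CARD('n)
     (\<lambda>(i, j). A $ from_nat_into UNIV i $ from_nat_into UNIV j)"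

lemma to_nat_indexed_carrier [simp]:
  "to_nat_indexed (A :: real^'n^'n) \<in> carrier_mat CARD('n) CARD('n)"
  by (simp add: to_nat_indexed_def)

lemma to_nat_on_less_card: "to_nat_on UNIV (i :: 'n::finite) < CARD('n)"
  using to_nat_on_finite[of "UNIV :: 'n set"] by (auto simp: bij_betw_def)

lemma from_nat_indexed_inverse: "from_nat_indexed (to_nat_indexed A) = (A :: real^'n^'n)"
  by (simp add: vec_eq_iff from_nat_indexed_def to_nat_indexed_def to_nat_on_less_card)

lemma sum_nat_indexed:
  "(\<Sum>i<CARD('n::finite). f i) = (\<Sum>i\<in>(UNIV :: 'n set). f (to_nat_on UNIV i))"
  using sum.reindex_bij_betw[OF to_nat_on_finite[of "UNIV :: 'n set"], of f] by simp

lemma from_nat_indexed_mult: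
  assumes "A \<in> carrier_mat CARD('n) CARD('n)" "B \<in> carrier_mat CARD('n) CARD('n)"
  shows "(from_nat_indexed (A * B) :: real^'n^'n) = from_nat_indexed A ** from_nat_indexed B"
  using assms
  by (simp add: vec_eq_iff from_nat_indexed_def matrix_matrix_mult_def scalar_prod_def
      to_nat_on_less_card atLeast0LessThan sum_nat_indexed)

lemma from_nat_indexed_one:
  "(from_nat_indexed (1\<^sub>m CARD('n)) :: real^'n^'n) = mat 1"
  by (simp add: vec_eq_iff from_nat_indexed_def mat_def to_nat_on_less_card)

text \<open>\<open>x\<close> and \<open>y\<close> are the real and imaginary parts of a complex
  eigenvector; the equations compare real and imaginary parts coordinate by coordinate.\<close>

lemma real_eigenpair_of_eigenvalue:
  fixes A :: "real^'n^'n"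
  assumes "eigenvalue (map_mat complex_of_real (to_nat_indexed A)) z"
  obtains x y where "x \<noteq> 0 \<or> y \<noteq> 0"
    "A *v x = Re z *\<^sub>R x - Im z *\<^sub>R y" "A *v y = Im z *\<^sub>R x + Re z *\<^sub>R y"
proof -
  let ?M = "map_mat complex_of_real (to_nat_indexed A)" and ?e = "to_nat_on (UNIV :: 'n set)"
  have dim: "dim_row ?M = CARD('n)" "dim_col ?M = CARD('n)"
    by (simp_all add: to_nat_indexed_def)
  obtain v where v: "v \<in> carrier_vec CARD('n)" "v \<noteq> 0\<^sub>v CARD('n)" "?M *\<^sub>v v = z \<cdot>\<^sub>v v"
    using assms dim by (auto simp: eigenvalue_def eigenvector_def)
  define x y :: "real^'n" where "x = (\<chi> i. Re (vec_index v (?e i)))" and "y = (\<chi> i. Im (vec_index v (?e i)))"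
  have "\<exists>i. vec_index v (?e i) \<noteq> 0"
  proof (rule ccontr)
    assume "\<not> ?thesis"
    moreover have "\<exists>i. j = ?e i" if "j < CARD('n)" for j
      using that to_nat_on_finite[of "UNIV :: 'n set"] by (auto simp: bij_betw_def)
    ultimately have "v = 0\<^sub>v CARD('n)" using v(1) by (intro eq_vecI) auto
    with v(2) show False ..
  qed
  then have "x \<noteq> 0 \<or> y \<noteq> 0" by (auto simp: x_def y_def vec_eq_iff complex_eq_iff)
  moreover have mult: "(\<Sum>j\<in>UNIV. of_real (A $ i $ j) * vec_index v (?e j)) = z * vec_index v (?e i)" for i
  proof -
    have "vec_index (?M *\<^sub>v v) (?e i) = (\<Sum>j<CARD('n). ?M $$ (?e i, j) * vec_index v j)"
      using v(1) dim by (simp add: scalar_prod_def to_nat_on_less_card atLeast0LessThan)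
    also have "\<dots> = (\<Sum>j\<in>UNIV. of_real (A $ i $ j) * vec_index v (?e j))"
      by (simp add: sum_nat_indexed to_nat_indexed_def to_nat_on_less_card)
    finally show ?thesis using v by (simp add: to_nat_on_less_card)
  qed
  have "A *v x = Re z *\<^sub>R x - Im z *\<^sub>R y"
    using arg_cong[OF mult, of Re] by (simp add: vec_eq_iff x_def y_def matrix_vector_mult_def)
  moreover have "A *v y = Im z *\<^sub>R x + Re z *\<^sub>R y"
    using arg_cong[OF mult, of Im] by (simp add: vec_eq_iff x_def y_def matrix_vector_mult_def add.commute)
  ultimately show ?thesis by (rule that)
qed

lemma matrix_inv_eqI:
  fixes A B :: "real^'n^'n"
  assumes "A ** B = mat 1" "B ** A = mat 1"
  shows "matrix_inv A = B"
  unfolding matrix_inv_def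
proof (rule someI2)
  show "A ** B = mat 1 \<and> B ** A = mat 1" using assms ..
next
  fix C assume "A ** C = mat 1 \<and> C ** A = mat 1"
  then have "C = C ** (A ** B)" "B = (C ** A) ** B" using assms by simp_all
  then show "C = B" by (simp add: matrix_mul_assoc)
qed

lemma endo_of_matrix_unique_log:
  fixes Y :: "real^'n^'n"
  assumes "\<And>Z. matrix_exp Z = matrix_exp Y \<Longrightarrow> Z = Y" "exp z = exp (endo_of_matrix Y)"
  shows "z = endo_of_matrix Y"
proof -
  have "matrix_exp (matrix_of_endo z) = matrix_exp Y"
    by (simp add: matrix_exp_eq assms(2))
  then show ?thesis using assms(1) by (metis endo_of_matrix_inverse)
qed

text \<open>All complex eigenvalues turn out to be positive reals, so the characteristic polynomial
  splits over the reals and a real Jordan form exists. A repeated block is then excluded by the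
  rotation of the two copies.\<close>

lemma positive_distinct_jordan_of_unique_log:
  fixes Y :: "real^'n^'n"
  assumes unique: "\<And>Z. matrix_exp Z = matrix_exp Y \<Longrightarrow> Z = Y"
  shows "positive_distinct_jordan (matrix_exp Y)"
proof -
  define X where "X = matrix_exp Y"
  let ?M = "to_nat_indexed X" and ?n = "CARD('n)"
  have expY: "exp (endo_of_matrix Y) = endo_of_matrix X" by (simp add: X_def endo_of_matrix_exp)
  note uniq = endo_of_matrix_unique_log[OF unique]
  interpret of_real_poly: map_poly_inj_idom_hom complex_of_real ..
  let ?Mc = "map_mat complex_of_real ?M"
  have Mc: "?Mc \<in> carrier_mat ?n ?n" by simp
  obtain as where as: "char_poly ?Mc = (\<Prod>a\<leftarrow>as. [:- a, 1:])"
    using char_poly_factorized[OF Mc] by blast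
  have pos: "Im a = 0 \<and> Re a > 0" if "a \<in> set as" for a
  proof -
    have "poly (char_poly ?Mc) a = 0"
      using that by (auto simp: as poly_prod_list prod_list_zero_iff)
    then have "eigenvalue ?Mc a" using eigenvalue_root_char_poly[OF Mc] by blast
    then obtain x y where "x \<noteq> 0 \<or> y \<noteq> 0"
       "X *v x = Re a *\<^sub>R x - Im a *\<^sub>R y" "X *v y = Im a *\<^sub>R x + Re a *\<^sub>R y"
      by (rule real_eigenpair_of_eigenvalue)
    then show ?thesis
      using eigenpair_exp_unique_log[OF uniq, of x "Re a" "Im a" y] by (simp add: expY)
  qed
  define rs where "rs = map Re as"
  have rs: "r > 0" if "r \<in> set rs" for r using that pos by (auto simp: rs_def)
  have "map complex_of_real rs = as"
    unfolding rs_def map_map by (rule map_idI) (use pos in \<open>simp add: complex_eq_iff\<close>)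
  then have "char_poly ?Mc = (\<Prod>a\<leftarrow>map complex_of_real rs. [:- a, 1:])"
    using as by simp
  also have "\<dots> = (\<Prod>r\<leftarrow>rs. [:- complex_of_real r, 1:])" by (simp add: o_def)
  also have "\<dots> = map_poly complex_of_real (\<Prod>r\<leftarrow>rs. [:- r, 1:])"
    unfolding of_real_poly.hom_prod_list map_map
    by (rule arg_cong[of _ _ prod_list]) (simp add: map_poly_pCons)
  also have "char_poly ?Mc = map_poly complex_of_real (char_poly ?M)"
    by (rule of_real_hom.char_poly_hom[OF to_nat_indexed_carrier])
  \<comment> \<open>The embedding of real polynomials into complex ones is injective, which brings
    the factorization back to the reals.\<close>
  finally have charM: "char_poly ?M = (\<Prod>r\<leftarrow>rs. [:- r, 1:])" by simp
  then obtain bs where bs: "jordan_nf ?M bs"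
    using jordan_nf_exists[OF to_nat_indexed_carrier] by blast
  then have bs0: "0 \<notin> fst ` set bs" by (simp add: jordan_nf_def)
  obtain P Q where "similar_mat_wit ?M (jordan_matrix bs) P Q"
    using bs by (auto simp: jordan_nf_def similar_mat_def)
  note w = similar_mat_witD2[OF to_nat_indexed_carrier this]
  have dim: "sum_list (map fst bs) = ?n"
    using w(5) by (metis carrier_matD(1) jordan_matrix_dim(1))
  define C C' :: "real^'n^'n" where "C = from_nat_indexed Q" and "C' = from_nat_indexed P"
  let ?D = "from_nat_indexed (jordan_matrix bs) :: real^'n^'n"
  have CC: "C ** C' = mat 1" "C' ** C = mat 1"
    using w by (simp_all add: C_def C'_def from_nat_indexed_one flip: from_nat_indexed_mult)
  have "X = from_nat_indexed (P * jordan_matrix bs * Q)"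
    by (metis w(3) from_nat_indexed_inverse)
  also have "\<dots> = C' ** ?D ** C"
    using w(5-7) by (simp add: from_nat_indexed_mult C_def C'_def matrix_mul_assoc)
  finally have X: "X = C' ** ?D ** C" .
  have pos_bs: "k \<ge> 1 \<and> r > 0" if "(k, r) \<in> set bs" for k r
  proof -
    have k: "k \<ge> 1" using that bs0 by (cases k) force+
    \<comment> \<open>A block of positive size contributes its eigenvalue as a root of the
      characteristic polynomial.\<close>
    have "poly (\<Prod>(n, a)\<leftarrow>bs. [:- a, 1:] ^ n) r = 0"
      using that k by (force simp: poly_prod_list prod_list_zero_iff)
    then have "poly (\<Prod>r\<leftarrow>rs. [:- r, 1:]) r = 0"
      using jordan_nf_char_poly[OF bs] charM by simp
    then have "r \<in> set rs" by (auto simp: poly_prod_list prod_list_zero_iff)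
    with k rs show ?thesis by blast
  qed
  have "distinct bs"
  proof (rule ccontr)
    assume "\<not> distinct bs"
    then obtain J :: "real^'n^'n" where J: "J \<noteq> 0" "J ** J ** J = - J" "J ** ?D = ?D ** J"
      using partial_complex_structure_of_repeated_jordan_block bs0 dim by metis
    define j c c' where "j = endo_of_matrix J" and "c = endo_of_matrix C" and "c' = endo_of_matrix C'"
    have j: "j * j * j = - j"
      using arg_cong[OF J(2), of endo_of_matrix] endo_of_matrix_scaleR[of "-1" J]
      by (simp add: j_def endo_of_matrix_mult)
    have jD: "j * endo_of_matrix ?D = endo_of_matrix ?D * j"
      using arg_cong[OF J(3), of endo_of_matrix] by (simp add: j_def endo_of_matrix_mult)
    have cc: "c * c' = 1" "c' * c = 1"
      using CC[THEN arg_cong, of endo_of_matrix] by (simp_all add: c_def c'_def endo_of_matrix_mult)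
    have ccz: "c * (c' * z) = z" for z by (metis cc(1) mult.assoc mult_1)
    have x: "endo_of_matrix X = c' * endo_of_matrix ?D * c"
      by (simp add: X endo_of_matrix_mult c_def c'_def)
    \<comment> \<open>Conjugation by \<open>C\<close> makes \<open>J\<close>, which commutes with
      the Jordan matrix, commute with \<open>X\<close> and preserves its cubic identity.\<close>
    have "c' * j * c = 0"
    proof (rule no_partial_complex_structure_of_unique_log[OF uniq])
      have "c' * j * c * (c' * j * c) * (c' * j * c) = c' * (j * j * j) * c"
        by (simp add: mult.assoc ccz)
      then show "c' * j * c * (c' * j * c) * (c' * j * c) = - (c' * j * c)" by (simp add: j)
      have "c' * j * c * (c' * endo_of_matrix ?D * c) = c' * (j * endo_of_matrix ?D) * c"
        by (simp add: mult.assoc ccz)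
      also have "\<dots> = c' * endo_of_matrix ?D * c * (c' * j * c)"
        by (simp add: jD mult.assoc ccz)
      finally show "c' * j * c * exp (endo_of_matrix Y) = exp (endo_of_matrix Y) * (c' * j * c)"
        by (simp only: expY x)
    qed
    then have "c * (c' * j * c) * c' = 0" by simp
    then have "j = 0" by (simp add: mult.assoc ccz cc)
    with J(1) show False by (metis endo_of_matrix_eq_iff endo_of_matrix_zero j_def)
  qed
  moreover have "invertible C" using CC by (auto simp: invertible_def)
  moreover have "X = matrix_inv C ** ?D ** C" using X CC by (simp add: matrix_inv_eqI)
  ultimately show ?thesis
    using dim pos_bs unfolding positive_distinct_jordan_def X_def[symmetric] by blast
qed

section \<open>Geodesics of the trace metric\<close>

text \<open>Supplies the product rule and the linearity laws for the true matrix product.\<close>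

interpretation matrix_mult: bounded_bilinear
  "(**) :: real^'n^'m \<Rightarrow> real^'p^'n \<Rightarrow> real^'p^'m"
  unfolding bilinear_conv_bounded_bilinear[symmetric] bilinear_def
  by (auto intro!: linearI simp: vec_eq_iff matrix_matrix_mult_def sum_distrib_left
      sum.distrib algebra_simps)

lemma GL_iff: "A \<in> GL \<longleftrightarrow> matrix_inv A ** A = mat 1 \<and> A ** matrix_inv A = mat 1"
  unfolding GL_def by (auto simp: invertible_def intro: matrix_inv_eqI dest: matrix_inv_eqI)

lemma open_GL: "open (GL :: (real^'n^'n) set)"
proof -
  have "continuous_on UNIV (det :: real^'n^'n \<Rightarrow> real)"
    unfolding det_def by (intro continuous_intros)
  then have "open {A :: real^'n^'n. det A \<noteq> 0}"
    by (intro open_Collect_neq) auto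
  then show ?thesis by (simp add: GL_def invertible_det_nz)
qed

section \<open>The derivative of matrix inversion\<close>

text \<open>Using \<open>y - x = - y (b - a) x\<close> twice turns the remainder into
  \<open>y (b - a) x (b - a) x\<close>, and smallness of \<open>b - a\<close> gives
  \<open>norm y \<le> 2 * norm x\<close>.\<close>

lemma norm_inverse_remainder:
  fixes a b x y :: "'a::real_normed_algebra_1"
  assumes "a * x = 1" "x * a = 1" "b * y = 1" "y * b = 1" and small: "norm x * norm (b - a) \<le> 1/2"
  shows "norm (y - x + x * (b - a) * x) \<le> 2 * norm x ^ 3 * (norm (b - a))\<^sup>2"
proof -
  have x: "z * a * x = z" "z * x * a = z" "z * b * y = z" "z * y * b = z" for z
    by (simp_all add: mult.assoc assms)
  have yx: "y - x = - (y * (b - a) * x)"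
    by (simp add: algebra_simps x flip: mult.assoc) (simp add: assms)
  then have "y = x - y * (b - a) * x" by (simp add: diff_eq_eq)
  then have "norm y = norm (x - y * (b - a) * x)" by (rule arg_cong)
  also have "\<dots> \<le> norm x + norm (y * (b - a) * x)" by (rule norm_triangle_ineq4)
  also have "norm (y * (b - a) * x) \<le> norm y * norm (b - a) * norm x"
    by (intro order_trans[OF norm_mult_ineq] mult_right_mono norm_mult_ineq) simp
  also have "\<dots> = norm y * (norm x * norm (b - a))" by simp
  also have "\<dots> \<le> norm y * (1/2)" by (intro mult_left_mono small) simp
  finally have y: "norm y \<le> 2 * norm x" by simp
  have "y - x + x * (b - a) * x = - ((y - x) * (b - a) * x)"
    using yx by (simp add: algebra_simps)
  also have "\<dots> = y * (b - a) * x * (b - a) * x" by (simp add: yx)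
  also have "norm \<dots> \<le> norm y * norm (b - a) * norm x * norm (b - a) * norm x"
    by (intro order_trans[OF norm_mult_ineq] mult_right_mono norm_mult_ineq) simp_all
  also have "\<dots> \<le> (2 * norm x) * norm (b - a) * norm x * norm (b - a) * norm x"
    by (intro mult_right_mono y) simp_all
  finally show ?thesis by (simp add: power2_eq_square power3_eq_cube mult_ac)
qed

lemma has_derivative_matrix_inv:
  fixes A :: "real^'n^'n"
  assumes "A \<in> GL"
  shows "(matrix_inv has_derivative (\<lambda>Z. - (matrix_inv A ** Z ** matrix_inv A))) (at A)"
proof -
  define a x where "a = endo_of_matrix A" and "x = endo_of_matrix (matrix_inv A)"
  define f where "f b = endo_of_matrix (matrix_inv (matrix_of_endo b))" for b :: "'n endo"
  have inv: "b * f b = 1" "f b * b = 1" if "matrix_of_endo b \<in> GL" for b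
    using that[unfolded GL_iff, THEN conjunct1, THEN arg_cong[of _ _ endo_of_matrix]]
      that[unfolded GL_iff, THEN conjunct2, THEN arg_cong[of _ _ endo_of_matrix]]
    by (simp_all add: f_def endo_of_matrix_mult)
  have fa: "f a = x" by (simp add: f_def x_def a_def)
  have "matrix_of_endo a \<in> GL" using assms by (simp add: a_def)
  then have ax: "a * x = 1" "x * a = 1" using inv[of a] by (simp_all add: fa)
  have "open (matrix_of_endo -` (GL :: (real^'n^'n) set))"
    using open_GL bounded_linear_matrix_of_endo
    by (intro open_vimage linear_continuous_on)
  moreover have "a \<in> matrix_of_endo -` GL" using assms by (simp add: a_def)
  ultimately obtain e where e: "e > 0" "\<And>b. dist b a < e \<Longrightarrow> matrix_of_endo b \<in> GL"
    by (auto simp: open_dist)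
  have xpos: "norm x > 0" using ax by auto
  have "(f has_derivative (\<lambda>z. - (x * z * x))) (at a)"
  proof (rule has_derivativeI_sandwich)
    \<comment> \<open>The first bound keeps \<open>b\<close> invertible; the second is the smallness
      condition of \<open>norm_inverse_remainder\<close>.\<close>
    show "min e (1 / (2 * norm x)) > 0" using e xpos by simp
    show "bounded_linear (\<lambda>z. - (x * z * x))"
      by (intro bounded_linear_minus bounded_linear_mult_left[THEN bounded_linear_compose]
          bounded_linear_mult_right)
    fix b assume b: "b \<noteq> a" "dist b a < min e (1 / (2 * norm x))"
    then have "norm x * norm (b - a) \<le> 1/2" using xpos by (simp add: dist_norm field_simps)
    from norm_inverse_remainder[OF ax inv[OF e(2)] this] b
    have "norm (f b - x + x * (b - a) * x) \<le> 2 * norm x ^ 3 * (norm (b - a))\<^sup>2" by simp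
    then show "norm (f b - f a - - (x * (b - a) * x)) / norm (b - a) \<le> 2 * norm x ^ 3 * norm (b - a)"
      using b(1) by (simp add: fa divide_le_eq power2_eq_square mult_ac)
  next
    show "((\<lambda>b. 2 * norm x ^ 3 * norm (b - a)) \<longlongrightarrow> 0) (at a)"
      by (auto intro!: tendsto_eq_intros)
  qed
  then have "(f has_derivative (\<lambda>z. - (x * z * x))) (at (endo_of_matrix A))" by (simp add: a_def)
  from has_derivative_compose[OF bounded_linear_imp_has_derivative[OF bounded_linear_endo_of_matrix] this]
  have "((\<lambda>B. matrix_of_endo (f (endo_of_matrix B))) has_derivative
      (\<lambda>Z. matrix_of_endo (- (x * endo_of_matrix Z * x)))) (at A)"
    by (rule bounded_linear.has_derivative[OF bounded_linear_matrix_of_endo])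
  then show ?thesis
    by (simp add: f_def x_def linear_neg[OF bounded_linear.linear[OF bounded_linear_matrix_of_endo]]
        flip: endo_of_matrix_mult)
qed

text \<open>The symmetrization of \<open>- V A\<^sup>-\<^sup>1 W\<close>, for which the geodesic
  equation reads \<open>\<gamma>'' = \<gamma>' \<gamma>\<^sup>-\<^sup>1 \<gamma>'\<close>.\<close>

definition gl_christoffel :: "real^'n^'n \<Rightarrow> real^'n^'n \<Rightarrow> real^'n^'n \<Rightarrow> real^'n^'n" where
  "gl_christoffel A V W = - (1/2) *\<^sub>R (V ** matrix_inv A ** W + W ** matrix_inv A ** V)"

lemma linear_trace: "linear (trace :: real^'n^'n \<Rightarrow> real)"
  by (rule linearI) (simp_all add: trace_def sum.distrib sum_distrib_left)

lemma bounded_linear_trace: "bounded_linear (trace :: real^'n^'n \<Rightarrow> real)"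
  using linear_trace by (simp add: linear_conv_bounded_linear)

lemmas trace_simps = linear_add[OF linear_trace] linear_diff[OF linear_trace]
  linear_neg[OF linear_trace] linear_scale[OF linear_trace]

lemmas matrix_mult_simps = matrix_mult.add_left matrix_mult.add_right matrix_mult.diff_left
  matrix_mult.diff_right matrix_mult.minus_left matrix_mult.minus_right
  matrix_mult.scaleR_left matrix_mult.scaleR_right

lemma has_derivative_gl_metric:
  fixes A :: "real^'n^'n"
  assumes "A \<in> GL"
  defines "i \<equiv> matrix_inv A"
  shows "((\<lambda>B. gl_metric B V W) has_derivative
     (\<lambda>Z. - trace (i ** Z ** i ** V ** i ** W) - trace (i ** V ** i ** Z ** i ** W))) (at A)"
proof -
  note d = has_derivative_matrix_inv[OF assms(1)]
  have "((\<lambda>B. matrix_inv B ** V ** matrix_inv B ** W) has_derivative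
     (\<lambda>Z. (matrix_inv A ** V ** - (i ** Z ** i) + - (i ** Z ** i) ** V ** matrix_inv A) ** W)) (at A)"
    unfolding i_def
    by (intro matrix_mult.bounded_linear_left[THEN bounded_linear.has_derivative]
        matrix_mult.FDERIV d)
  from bounded_linear.has_derivative[OF bounded_linear_trace this]
  show ?thesis
    by (simp add: gl_metric_def i_def matrix_mult_simps trace_simps matrix_mul_assoc algebra_simps)
qed

lemma levi_civita_on_gl_christoffel:
  "levi_civita_on GL gl_metric (gl_christoffel :: real^'n^'n \<Rightarrow> _)"
  unfolding levi_civita_on_def
proof (intro ballI conjI allI)
  fix A V W :: "real^'n^'n" assume A: "A \<in> GL"
  show "bilinear (gl_christoffel A)"
    unfolding bilinear_def gl_christoffel_def
    by (auto intro!: linearI simp: matrix_mult_simps algebra_simps)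
  show "gl_christoffel A V W = gl_christoffel A W V"
    by (simp add: gl_christoffel_def add.commute)
  have inv: "matrix_inv A ** A = mat 1" "A ** matrix_inv A = mat 1" using A by (auto simp: GL_iff)
  define i where "i = matrix_inv A"
  have "gl_metric A (gl_christoffel A Z V) W + gl_metric A V (gl_christoffel A Z W) =
     - trace (i ** Z ** i ** V ** i ** W) - trace (i ** V ** i ** Z ** i ** W)" for Z
  proof -
    \<comment> \<open>Expanding both metric terms gives four traces with factor one half; cyclic
      invariance makes them agree in pairs.\<close>
    have "trace (i ** V ** i ** (W ** i ** Z)) = trace ((i ** V ** i ** W) ** (i ** Z))"
      by (simp add: matrix_mul_assoc)
    also have "\<dots> = trace ((i ** Z) ** (i ** V ** i ** W))" by (rule trace_mul_sym)
    finally have "trace (i ** V ** i ** W ** i ** Z) = trace (i ** Z ** i ** V ** i ** W)"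
      by (simp add: matrix_mul_assoc)
    then show ?thesis
      unfolding gl_metric_def gl_christoffel_def i_def[symmetric]
      by (simp add: matrix_mult_simps trace_simps matrix_mul_assoc field_simps)
  qed
  then show "((\<lambda>B. gl_metric B V W) has_derivative
       (\<lambda>Z. gl_metric A (gl_christoffel A Z V) W + gl_metric A V (gl_christoffel A Z W))) (at A)"
    using has_derivative_gl_metric[OF A, of V W] by (simp add: i_def)
qed

text \<open>Testing against the transpose of
  \<open>B = A\<^sup>-\<^sup>1 U A\<^sup>-\<^sup>1\<close> gives the sum of the squares of the
  entries of \<open>B\<close>.\<close>

lemma gl_metric_nondegenerate:
  fixes U :: "real^'n^'n"
  assumes "A \<in> GL" "\<And>W. gl_metric A U W = 0"
  shows "U = 0"
proof -
  define B where "B = matrix_inv A ** U ** matrix_inv A"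
  have "trace (B ** transpose B) = 0" using assms(2)[of "transpose B"] by (simp add: gl_metric_def B_def)
  then have "(\<Sum>i\<in>UNIV. \<Sum>j\<in>UNIV. (B $ i $ j)\<^sup>2) = 0"
    by (simp add: trace_def matrix_matrix_mult_def transpose_def power2_eq_square)
  then have "B = 0" by (simp add: sum_nonneg_eq_0_iff sum_nonneg vec_eq_iff)
  then have "A ** B ** A = 0" by simp
  moreover have "A ** B ** A = (A ** matrix_inv A) ** U ** (matrix_inv A ** A)"
    by (simp add: B_def matrix_mul_assoc)
  ultimately show ?thesis using assms(1) by (simp add: GL_iff)
qed

text \<open>
  The difference \<open>\<Delta>\<close> of two Levi-Civita connections makes \<open>g(\<Delta>(Z, V), W)\<close> symmetric in \<open>Z, V\<close>
  and skew in \<open>V, W\<close>, hence zero.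
\<close>

lemma levi_civita_on_GL_unique:
  assumes \<Gamma>: "levi_civita_on GL gl_metric \<Gamma>" and A: "A \<in> GL"
  shows "\<Gamma> A V W = gl_christoffel A V W"
proof -
  define T where "T Z V W = gl_metric A (\<Gamma> A Z V - gl_christoffel A Z V) W" for Z V W
  have sym: "gl_metric A V W = gl_metric A W V" for V W
    using trace_mul_sym[of "matrix_inv A ** V" "matrix_inv A ** W"]
    by (simp add: gl_metric_def matrix_mul_assoc)
  have diff: "gl_metric A (U - V) W = gl_metric A U W - gl_metric A V W" for U V W
    by (simp add: gl_metric_def matrix_mult_simps trace_simps)
  have skew: "T Z V W = - T Z W V" for Z V W
  proof -
    have "(\<lambda>Z. gl_metric A (\<Gamma> A Z V) W + gl_metric A V (\<Gamma> A Z W)) =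
      (\<lambda>Z. gl_metric A (gl_christoffel A Z V) W + gl_metric A V (gl_christoffel A Z W))"
      using \<Gamma> levi_civita_on_gl_christoffel A unfolding levi_civita_on_def
      by (blast intro: has_derivative_unique)
    from fun_cong[OF this, of Z] show ?thesis
      by (simp add: T_def diff sym[of V])
  qed
  have tsym: "T Z V W = T V Z W" for Z V W
    using \<Gamma> levi_civita_on_gl_christoffel[where 'n='a] A by (simp add: T_def levi_civita_on_def)
  \<comment> \<open>Alternating the two rules runs through all six orders of the arguments and ends
    at \<open>T Z V W = - T Z V W\<close>.\<close>
  have "T Z V W = 0" for Z V W
    using skew[of Z V W] tsym[of Z W V] skew[of W Z V] tsym[of W V Z] skew[of V W Z] tsym[of V Z W]
    by simp
  then have "\<Gamma> A V W - gl_christoffel A V W = 0"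
    by (intro gl_metric_nondegenerate[OF A]) (simp add: T_def)
  then show ?thesis by simp
qed

section \<open>Exponential curves and geodesics\<close>

lemma has_vector_derivative_matrix_exp:
  fixes V :: "real^'n^'n"
  shows "((\<lambda>t. matrix_exp (t *\<^sub>R V)) has_vector_derivative matrix_exp (t *\<^sub>R V) ** V) (at t within S)"
proof -
  have "((\<lambda>t. matrix_of_endo (exp (t *\<^sub>R endo_of_matrix V))) has_vector_derivative
     matrix_of_endo (exp (t *\<^sub>R endo_of_matrix V) * endo_of_matrix V)) (at t within S)"
    by (intro bounded_linear.has_vector_derivative[OF bounded_linear_matrix_of_endo]
        exp_scaleR_has_vector_derivative_right)
  then show ?thesis
    by (simp add: matrix_exp_eq endo_of_matrix_scaleR matrix_of_endo_mult)
qed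

lemma matrix_exp_scaleR_commute: "matrix_exp (t *\<^sub>R V) ** V = V ** matrix_exp (t *\<^sub>R V)"
  by (simp add: exp_times_scaleR_commute endo_of_matrix_mult endo_of_matrix_exp endo_of_matrix_scaleR
      flip: endo_of_matrix_eq_iff)

lemma matrix_exp_0: "matrix_exp 0 = mat 1"
  by (simp add: matrix_exp_eq matrix_of_endo_eqI)

lemma matrix_exp_minus: "matrix_exp Y ** matrix_exp (- Y) = mat 1"
  using exp_minus_inverse[of "endo_of_matrix Y"] endo_of_matrix_scaleR[of "-1" Y]
  by (simp add: matrix_exp_eq matrix_of_endo_eqI flip: matrix_of_endo_mult)

lemma exp_curve_GL:
  fixes K V :: "real^'n^'n"
  assumes "K \<in> GL"
  defines "\<gamma> \<equiv> \<lambda>t. K ** matrix_exp (t *\<^sub>R V)"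
  shows "\<gamma> t \<in> GL" "matrix_inv (\<gamma> t) ** \<gamma> t = mat 1"
proof -
  have "invertible (matrix_exp (t *\<^sub>R V))"
    using matrix_exp_minus[of "t *\<^sub>R V"] matrix_exp_minus[of "- (t *\<^sub>R V)"]
    by (auto simp: invertible_def)
  then show "\<gamma> t \<in> GL" using assms(1) by (simp add: GL_def \<gamma>_def invertible_mult)
  then show "matrix_inv (\<gamma> t) ** \<gamma> t = mat 1" by (simp add: GL_iff)
qed

text \<open>The \<open>k\<close>-th derivative of the curve is \<open>\<gamma> V\<^sup>k\<close>,
  and the Christoffel term is \<open>- \<gamma> V \<gamma>\<^sup>-\<^sup>1 \<gamma> V = - \<gamma>
  V\<^sup>2\<close>.\<close>

lemma geodesic_arc_exp:
  fixes K V :: "real^'n^'n"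
  assumes K: "K \<in> GL"
  shows "geodesic_arc GL gl_metric K (K ** matrix_exp V) (\<lambda>t. K ** matrix_exp (t *\<^sub>R V))"
proof -
  let ?\<gamma> = "\<lambda>t. K ** matrix_exp (t *\<^sub>R V)"
  define d where "d k t = ?\<gamma> t ** matrix_pow V k" for k t
  have pow: "matrix_pow V (Suc k) = V ** matrix_pow V k" for k by (simp add: matrix_pow_def)
  have d: "d 0 t = ?\<gamma> t" "d 1 t = ?\<gamma> t ** V" "d 2 t = ?\<gamma> t ** V ** V" for t
    by (simp_all add: d_def matrix_pow_def numeral_2_eq_2 matrix_mul_assoc)
  have "(d k has_vector_derivative d (Suc k) t) (at t within {0..1})" for k t
  proof -
    have "(d k has_vector_derivative K ** (matrix_exp (t *\<^sub>R V) ** V) ** matrix_pow V k) (at t within {0..1})"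
      unfolding d_def
      by (intro matrix_mult.bounded_linear_left[THEN bounded_linear.has_vector_derivative]
          matrix_mult.bounded_linear_right[THEN bounded_linear.has_vector_derivative]
          has_vector_derivative_matrix_exp)
    then show ?thesis by (simp add: d_def pow matrix_mul_assoc)
  qed
  moreover have "d 2 t + gl_christoffel (?\<gamma> t) (d 1 t) (d 1 t) = 0" for t
  proof -
    have "?\<gamma> t ** V ** matrix_inv (?\<gamma> t) ** (?\<gamma> t ** V) = ?\<gamma> t ** V ** (matrix_inv (?\<gamma> t) ** ?\<gamma> t) ** V"
      by (simp only: matrix_mul_assoc)
    also have "\<dots> = ?\<gamma> t ** V ** V" using exp_curve_GL(2)[OF K, of t V] by simp
    finally show ?thesis unfolding d gl_christoffel_def by (simp flip: scaleR_2)
  qed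
  ultimately show ?thesis
    unfolding geodesic_arc_def
    using exp_curve_GL(1)[OF K, of _ V] d(1) levi_civita_on_gl_christoffel
    by (auto simp: matrix_exp_0 intro!: exI[of _ gl_christoffel] exI[of _ d])
qed

text \<open>Two quantities are constant along the arc: first
  \<open>\<gamma>\<^sup>-\<^sup>1 \<gamma>'\<close>, whose value is \<open>V\<close>, then
  \<open>\<gamma> exp(-tV)\<close>, whose value is \<open>K\<close>.\<close>

lemma geodesic_arc_GL_eq_exp:
  fixes K K' :: "real^'n^'n"
  assumes "geodesic_arc GL gl_metric K K' \<gamma>"
  obtains V where "\<And>t. t \<in> {0..1} \<Longrightarrow> \<gamma> t = K ** matrix_exp (t *\<^sub>R V)"
proof -
  let ?I = "{0..1::real}"
  from assms obtain \<Gamma> d where \<Gamma>: "levi_civita_on GL gl_metric \<Gamma>"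
    and GL: "\<And>t. t \<in> ?I \<Longrightarrow> \<gamma> t \<in> GL" and d0: "\<And>t. t \<in> ?I \<Longrightarrow> d 0 t = \<gamma> t"
    and d: "\<And>t k. t \<in> ?I \<Longrightarrow> (d k has_vector_derivative d (Suc k) t) (at t within ?I)"
    and geo: "\<And>t. t \<in> ?I \<Longrightarrow> d 2 t + \<Gamma> (\<gamma> t) (d 1 t) (d 1 t) = 0"
    and K: "\<gamma> 0 = K"
    unfolding geodesic_arc_def by blast
  have inv: "matrix_inv (\<gamma> t) ** \<gamma> t = mat 1" "\<gamma> t ** matrix_inv (\<gamma> t) = mat 1" if "t \<in> ?I" for t
    using GL[OF that] by (simp_all add: GL_iff)
  have d1: "(\<gamma> has_vector_derivative d 1 t) (at t within ?I)" if "t \<in> ?I" for t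
    unfolding One_nat_def by (rule has_vector_derivative_transform[OF that _ d[OF that]]) (simp add: d0)
  have d2: "(d 1 has_vector_derivative d 1 t ** matrix_inv (\<gamma> t) ** d 1 t) (at t within ?I)"
    if t: "t \<in> ?I" for t
  proof -
    \<comment> \<open>The connection \<open>\<Gamma>\<close> comes from an existential quantifier;
      uniqueness on \<open>GL\<close> identifies it with \<open>gl_christoffel\<close>.\<close>
    have "d 2 t = d 1 t ** matrix_inv (\<gamma> t) ** d 1 t"
      using geo[OF t] levi_civita_on_GL_unique[OF \<Gamma> GL[OF t]]
      by (simp add: gl_christoffel_def flip: scaleR_2)
    with d[OF t, of 1] show ?thesis by (simp add: numeral_2_eq_2)
  qed
  have di: "((\<lambda>t. matrix_inv (\<gamma> t)) has_vector_derivative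
      - (matrix_inv (\<gamma> t) ** d 1 t ** matrix_inv (\<gamma> t))) (at t within ?I)" if t: "t \<in> ?I" for t
  proof -
    from has_derivative_matrix_inv[OF GL[OF t]]
    have "((\<lambda>t. matrix_inv (\<gamma> t)) has_derivative
       (\<lambda>s. - (matrix_inv (\<gamma> t) ** (s *\<^sub>R d 1 t) ** matrix_inv (\<gamma> t)))) (at t within ?I)"
      by (rule has_derivative_compose[OF d1[OF t, unfolded has_vector_derivative_def]])
    then show ?thesis by (simp add: has_vector_derivative_def matrix_mult_simps)
  qed
  have "((\<lambda>t. matrix_inv (\<gamma> t) ** d 1 t) has_vector_derivative 0) (at t within ?I)" if t: "t \<in> ?I" for t
    using matrix_mult.has_vector_derivative[OF di[OF t] d2[OF t]]
    by (simp add: matrix_mult_simps matrix_mul_assoc)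
  then obtain V where V: "\<And>t. t \<in> ?I \<Longrightarrow> matrix_inv (\<gamma> t) ** d 1 t = V"
    using has_vector_derivative_zero_constant[of ?I "\<lambda>t. matrix_inv (\<gamma> t) ** d 1 t"] by auto
  have d1V: "d 1 t = \<gamma> t ** V" if "t \<in> ?I" for t
    using inv(2)[OF that] by (simp add: V[OF that, symmetric] matrix_mul_assoc)
  \<comment> \<open>With \<open>\<gamma>' = \<gamma> V\<close>, the two terms of the product rule
    cancel because \<open>V\<close> commutes with its own exponentials.\<close>
  have "((\<lambda>t. \<gamma> t ** matrix_exp (t *\<^sub>R - V)) has_vector_derivative 0) (at t within ?I)" if t: "t \<in> ?I" for t
  proof -
    have "V ** matrix_exp (t *\<^sub>R - V) = matrix_exp (t *\<^sub>R - V) ** V"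
      using matrix_exp_scaleR_commute[of t "- V"] by (simp add: matrix_mult_simps)
    then show ?thesis
      using matrix_mult.has_vector_derivative[OF d1[OF t] has_vector_derivative_matrix_exp[of "- V" t ?I]]
      by (simp add: matrix_mult_simps d1V[OF t, unfolded One_nat_def] matrix_mul_assoc[symmetric])
  qed
  then obtain C where C: "\<And>t. t \<in> ?I \<Longrightarrow> \<gamma> t ** matrix_exp (t *\<^sub>R - V) = C"
    using has_vector_derivative_zero_constant[of ?I "\<lambda>t. \<gamma> t ** matrix_exp (t *\<^sub>R - V)"] by auto
  have "C = K" using C[of 0] by (simp add: matrix_exp_0 K)
  have "\<gamma> t = K ** matrix_exp (t *\<^sub>R V)" if t: "t \<in> ?I" for t
  proof -
    have "\<gamma> t = \<gamma> t ** (matrix_exp (t *\<^sub>R - V) ** matrix_exp (t *\<^sub>R V))"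
      using matrix_exp_minus[of "- (t *\<^sub>R V)"] by simp
    then show ?thesis using C[OF t] \<open>C = K\<close> by (simp add: matrix_mul_assoc)
  qed
  then show ?thesis by (rule that)
qed

text \<open>Besides the formula, the conclusion records the Jordan shape and the unique logarithm
  that give the real power its meaning.\<close>

theorem proposition2p1:
  fixes K0 K1 :: "real^'n^'n" and \<gamma> :: "real \<Rightarrow> real^'n^'n"
  assumes "K0 \<in> GL" and "K1 \<in> GL"
    and "unique_geodesic_arc GL gl_metric K0 K1 \<gamma>"
  shows "positive_distinct_jordan (matrix_inv K0 ** K1) \<and>
         (\<exists>!Y. matrix_exp Y = matrix_inv K0 ** K1) \<and>
         (\<forall>t\<in>{0..1}. \<gamma> t = K0 ** matrix_powr (matrix_inv K0 ** K1) t)"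
proof -
  let ?X = "matrix_inv K0 ** K1"
  have K0: "matrix_inv K0 ** K0 = mat 1" "K0 ** matrix_inv K0 = mat 1"
    using assms(1) by (simp_all add: GL_iff)
  have arc: "geodesic_arc GL gl_metric K0 K1 \<gamma>"
    and arc_unique: "\<And>\<delta> t. geodesic_arc GL gl_metric K0 K1 \<delta> \<Longrightarrow> t \<in> {0..1} \<Longrightarrow> \<delta> t = \<gamma> t"
    using assms(3) by (auto simp: unique_geodesic_arc_def)
  obtain V where V: "\<And>t. t \<in> {0..1} \<Longrightarrow> \<gamma> t = K0 ** matrix_exp (t *\<^sub>R V)"
    using geodesic_arc_GL_eq_exp[OF arc] by blast
  have "K1 = K0 ** matrix_exp V"
    using V[of 1] arc by (simp add: geodesic_arc_def)
  then have X: "matrix_exp V = ?X" by (simp add: matrix_mul_assoc K0)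
  \<comment> \<open>A second logarithm gives a second exponential arc with the same end points,
    which must coincide with the first on the whole interval.\<close>
  have unique: "Y = V" if "matrix_exp Y = matrix_exp V" for Y
  proof -
    have "K0 ** matrix_exp Y = K1" using that X by (simp add: matrix_mul_assoc K0)
    with geodesic_arc_exp[OF assms(1), of Y]
    have "geodesic_arc GL gl_metric K0 K1 (\<lambda>t. K0 ** matrix_exp (t *\<^sub>R Y))" by simp
    from arc_unique[OF this] V
    have "K0 ** matrix_exp (t *\<^sub>R Y) = K0 ** matrix_exp (t *\<^sub>R V)" if "t \<in> {0..1}" for t
      using that by simp
    then have eq: "matrix_exp (t *\<^sub>R Y) = matrix_exp (t *\<^sub>R V)" if "t \<in> {0..1}" for t
      using that by (metis K0(1) matrix_mul_assoc matrix_mul_lid)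
    \<comment> \<open>The logarithm is recovered as the one-sided initial velocity, which is unique
      because 0 is a limit point of the interval.\<close>
    have "((\<lambda>t. matrix_exp (t *\<^sub>R V)) has_vector_derivative Y) (at 0 within {0..1})"
    proof (rule has_vector_derivative_transform)
      show "((\<lambda>t. matrix_exp (t *\<^sub>R Y)) has_vector_derivative Y) (at 0 within {0..1})"
        using has_vector_derivative_matrix_exp[of Y 0 "{0..1}"] by (simp add: matrix_exp_0)
    qed (simp_all add: eq)
    moreover have "((\<lambda>t. matrix_exp (t *\<^sub>R V)) has_vector_derivative V) (at 0 within {0..1})"
      using has_vector_derivative_matrix_exp[of V 0 "{0..1}"] by (simp add: matrix_exp_0)
    ultimately show "Y = V"
      by (rule vector_derivative_unique_within[rotated]) (simp add: trivial_limit_within islimpt_Icc)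
  qed
  have "positive_distinct_jordan ?X"
    using positive_distinct_jordan_of_unique_log[OF unique] X by simp
  moreover have ex1: "\<exists>!Y. matrix_exp Y = ?X" using X unique by metis
  moreover have "matrix_LOG ?X = V"
    unfolding matrix_LOG_def using X ex1 by (intro the1_equality)
  ultimately show ?thesis using V by (simp add: matrix_powr_def)
qed

end
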